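(* Let $B$ be a compact $3$-dimensional special integral affine manifold with local affine coordinates $\{x^1,x^2,x^3\}$, let $\hat X=T^*B/\hat\Lambda$ be the associated $T^3$-fibration over $B$ with its canonical symplectic form $\omega=\sum_{j=1}^3 dx^j\wedge dy_j$, and let $g=g(t)$ be a smooth one-parameter family of Hessian metrics on $B$ with local potentials $\phi=\phi(t)$, solving the flow (the semi-flat reduction of the Kähler–Ricci flow) $$\partial_t g_{jk}=\frac12\frac{\partial^2}{\partial x^j\partial x^k}\log\det g .$$ Let $\varphi=\varphi(t)$ and $\hat\varphi=\hat\varphi(t)$ be the associated $3$-forms on $\hat X$, i.e. the real and imaginary parts of $\Omega=dz_1\wedge dz_2\wedge dz_3$, where $z_j=x_j+iy_j$ and $x_j=\partial\phi/\partial x^j$. Then $\varphi$ satisfies the flow $$\partial_t\varphi=\frac12\,d\Lambda_\omega d\big(\log|\varphi|^2\cdot\hat\varphi\big).$$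
   Context: A special integral affine manifold $B$ of dimension $3$ is a manifold covered by local coordinate charts $\{x^1,x^2,x^3\}$ whose transition functions lie in $\mathrm{SL}(3,\mathbb Z)\ltimes\mathbb R^3$. A Hessian metric on $B$ is a Riemannian metric $g$ for which there is locally a convex function $\phi$ (the local potential) with $g_{jk}=\partial^2\phi/\partial x^j\partial x^k$; $\det g$ denotes $\det(g_{jk})$ in these affine coordinates, which is globally well defined. The affine structure $\{x^j\}$ on $B$ is fixed, while $g$ (equivalently $\phi$) varies with $t$. Let $\{y_1,y_2,y_3\}$ be the cotangent fibre coordinates on $T^*B$ associated to $\{x^1,x^2,x^3\}$ (the covector $\sum_j y_j\,dx^j$ has coordinates $y_j$), and let $\hat\Lambda=\mathbb Z\,dx^1+\mathbb Z\,dx^2+\mathbb Z\,dx^3$, a well-defined fibrewise lattice. Set $\hat X=T^*B/\hat\Lambda$; the form $\omega=\sum_j dx^j\wedge dy_j$ descends to $\hat X$ and is independent of $t$. The dual affine coordinates are $x_j=\partial\phi/\partial x^j$ (depending on $t$), so $dx_j=\sum_k g_{jk}\,dx^k$. With $z_j=x_j+iy_j$, put $\Omega=\varphi+i\hat\varphi=dz_1\wedge dz_2\wedge dz_3$, that is $$\varphi=dx_1\wedge dx_2\wedge dx_3-dx_1\wedge dy_2\wedge dy_3-dy_1\wedge dx_2\wedge dy_3-dy_1\wedge dy_2\wedge dx_3,$$ $$\hat\varphi=dx_1\wedge dx_2\wedge dy_3+dx_1\wedge dy_2\wedge dx_3+dy_1\wedge dx_2\wedge dx_3-dy_1\wedge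 dy_2\wedge dy_3.$$ These are well-defined forms on $\hat X$. The function $|\varphi|^2$ is defined by $\varphi\wedge\hat\varphi=|\varphi|^2\,\omega^3/3!$. $\Lambda_\omega$ is the contraction operator on forms associated with $\omega$, normalized by $\Lambda_\omega\omega=3$; explicitly $\Lambda_\omega=\sum_j\iota_{\partial/\partial y_j}\iota_{\partial/\partial x^j}$, where the vector fields are taken in the coordinates $(x^1,x^2,x^3,y_1,y_2,y_3)$. The time derivative $\partial_t\varphi$ is taken on the fixed manifold $\hat X$, with the coordinates $(x^j,y_j)$ fixed. *)

theory Defs
  imports "HOL-Analysis.Analysis"
begin

definition dir_deriv :: "'a::real_normed_vector \<Rightarrow> ('a \<Rightarrow> 'b::real_normed_vector) \<Rightarrow> 'a \<Rightarrow> 'b" where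
  "dir_deriv v f x = frechet_derivative f (at x) v"

abbreviation partial :: "3 \<Rightarrow> (real^3 \<Rightarrow> real) \<Rightarrow> real^3 \<Rightarrow> real" where
  "partial j \<equiv> dir_deriv (axis j 1)"

fun Ck_on :: "nat \<Rightarrow> 'a::real_normed_vector set \<Rightarrow> ('a \<Rightarrow> 'b::real_normed_vector) \<Rightarrow> bool" where
  "Ck_on 0 W f \<longleftrightarrow> continuous_on W f"
| "Ck_on (Suc k) W f \<longleftrightarrow> (\<forall>x\<in>W. f differentiable (at x)) \<and> (\<forall>v. Ck_on k W (dir_deriv v f))"

text \<open>\<open>S\<close> need not be open (it may be \<open>[0,T) \<times> U\<close>): smooth means locally extendable to a
  \<open>C\<^sup>\<infinity>\<close> function on an open set.  For open \<open>S\<close> this is ordinary smoothness.\<close>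
definition smooth_on :: "'a::real_normed_vector set \<Rightarrow> ('a \<Rightarrow> 'b::real_normed_vector) \<Rightarrow> bool" where
  "smooth_on S f \<longleftrightarrow>
     (\<forall>x\<in>S. \<exists>W h. open W \<and> x \<in> W \<and> (\<forall>k. Ck_on k W h) \<and> (\<forall>w\<in>W \<inter> S. f w = h w))"

type_synonym 'b chart = "'b set \<times> ('b \<Rightarrow> real^3)"

definition cdom :: "'b chart \<Rightarrow> 'b set" where "cdom c = fst c"
definition cmap :: "'b chart \<Rightarrow> 'b \<Rightarrow> real^3" where "cmap c = snd c"
definition cimg :: "'b chart \<Rightarrow> (real^3) set" where "cimg c = cmap c ` cdom c"
definition cinv :: "'b chart \<Rightarrow> real^3 \<Rightarrow> 'b" where "cinv c = inv_into (cdom c) (cmap c)"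

definition charts_at :: "'b chart set \<Rightarrow> 'b \<Rightarrow> 'b chart set" where
  "charts_at \<A> p = {c \<in> \<A>. p \<in> cdom c}"

definition SL3Z :: "(real^3^3) set" where
  "SL3Z = {A. (\<forall>i j. A $ i $ j \<in> \<int>) \<and> det A = 1}"

text \<open>Near \<open>p\<close> the change of coordinates from \<open>c\<close> to \<open>c'\<close> is affine with linear part \<open>A\<close>.\<close>
definition transition_at :: "'b::topological_space chart \<Rightarrow> 'b chart \<Rightarrow> 'b \<Rightarrow> real^3^3 \<Rightarrow> bool" where
  "transition_at c c' p A \<longleftrightarrow>
     (\<exists>b W. open W \<and> p \<in> W \<and> W \<subseteq> cdom c \<inter> cdom c' \<and> (\<forall>q\<in>W. cmap c' q = A *v cmap c q + b))"

text \<open>Overlaps of charts need not be connected, so the linear part in \<open>SL(3,\<int>)\<close> is only required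
  to be locally constant.\<close>
definition special_integral_affine :: "'b::topological_space chart set \<Rightarrow> bool" where
  "special_integral_affine \<A> \<longleftrightarrow>
     (\<forall>c\<in>\<A>. open (cdom c) \<and> open (cimg c) \<and> homeomorphism (cdom c) (cimg c) (cmap c) (cinv c)) \<and>
     (\<Union>c\<in>\<A>. cdom c) = UNIV \<and>
     (\<forall>c\<in>\<A>. \<forall>c'\<in>\<A>. \<forall>p\<in>cdom c \<inter> cdom c'. \<exists>A\<in>SL3Z. transition_at c c' p A)"

text \<open>A metric is given by its matrices of components \<open>g\<^sub>j\<^sub>k\<close> in all affine charts, subject to the
  transformation law of a covariant 2-tensor.\<close>
type_synonym 'b metric = "'b chart \<Rightarrow> 'b \<Rightarrow> real^3^3"

definition riemannian_metric :: "'b::topological_space chart set \<Rightarrow> 'b metric \<Rightarrow> bool" where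
  "riemannian_metric \<A> g \<longleftrightarrow>
     (\<forall>c\<in>\<A>. \<forall>p\<in>cdom c. transpose (g c p) = g c p \<and> (\<forall>v. v \<noteq> 0 \<longrightarrow> v \<bullet> (g c p *v v) > 0)) \<and>
     (\<forall>c\<in>\<A>. \<forall>j k. smooth_on (cimg c) (\<lambda>u. g c (cinv c u) $ j $ k)) \<and>
     (\<forall>c\<in>\<A>. \<forall>c'\<in>\<A>. \<forall>p A. transition_at c c' p A \<longrightarrow> g c p = transpose A ** g c' p ** A)"

definition local_potential ::
  "'b chart \<Rightarrow> 'b metric \<Rightarrow> 'b \<Rightarrow> (real^3) set \<Rightarrow> (real^3 \<Rightarrow> real) \<Rightarrow> bool" where
  "local_potential c g p V \<psi> \<longleftrightarrow>
     open V \<and> cmap c p \<in> V \<and> V \<subseteq> cimg c \<and> smooth_on V \<psi> \<and> convex_on V \<psi> \<and>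
     (\<forall>u\<in>V. \<forall>j k. g c (cinv c u) $ j $ k = partial j (partial k \<psi>) u)"

definition hessian_metric :: "'b::topological_space chart set \<Rightarrow> 'b metric \<Rightarrow> bool" where
  "hessian_metric \<A> g \<longleftrightarrow> riemannian_metric \<A> g \<and>
     (\<forall>p. \<forall>c\<in>charts_at \<A> p. \<exists>V \<psi>. local_potential c g p V \<psi>)"

definition smooth_metric_family :: "'b chart set \<Rightarrow> real set \<Rightarrow> (real \<Rightarrow> 'b metric) \<Rightarrow> bool" where
  "smooth_metric_family \<A> I g \<longleftrightarrow>
     (\<forall>c\<in>\<A>. \<forall>j k. smooth_on (I \<times> cimg c) (\<lambda>(t, u). g t c (cinv c u) $ j $ k))"

definition hessian_flow :: "'b chart set \<Rightarrow> real set \<Rightarrow> (real \<Rightarrow> 'b metric) \<Rightarrow> bool" where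
  "hessian_flow \<A> I g \<longleftrightarrow>
     (\<forall>t\<in>I. \<forall>p. \<forall>c\<in>charts_at \<A> p. \<forall>j k.
        ((\<lambda>s. g s c p $ j $ k) has_real_derivative
           1/2 * partial j (partial k (\<lambda>u. ln (det (g t c (cinv c u))))) (cmap c p)) (at t within I))"

text \<open>\<open>Inl j\<close> stands for \<open>x\<^sup>j\<close> and \<open>Inr j\<close> for \<open>y\<^sub>j\<close>.  A form \<open>\<alpha>\<close> (possibly of mixed degree) is
  stored as its coefficients: it is the sum over \<open>S\<close> of \<open>\<alpha> S\<close> times the wedge product of the
  basis covectors in \<open>S\<close>, taken in the order \<open>x\<^sup>1,x\<^sup>2,x\<^sup>3,y\<^sub>1,y\<^sub>2,y\<^sub>3\<close>.\<close>
type_synonym var = "3 + 3"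
type_synonym 'a form = "var set \<Rightarrow> 'a"

text \<open>In the type \<open>3\<close> the numeral \<open>3\<close> equals \<open>0\<close>, so its built-in order is not the one wanted.\<close>
definition num3 :: "3 \<Rightarrow> nat" where
  "num3 j = (if j = 1 then 1 else if j = 2 then 2 else 3)"

definition rank_var :: "var \<Rightarrow> nat" where
  "rank_var i = (case i of Inl j \<Rightarrow> num3 j | Inr j \<Rightarrow> 3 + num3 j)"

text \<open>The sign needed to sort the concatenation of the ordered lists of \<open>S\<close> and \<open>T\<close>.\<close>
definition shuffle_sign :: "var set \<Rightarrow> var set \<Rightarrow> 'a::comm_ring_1" where
  "shuffle_sign S T = (-1) ^ card {(i, j). i \<in> S \<and> j \<in> T \<and> rank_var j < rank_var i}"

definition covec :: "var \<Rightarrow> 'a::comm_ring_1 form" where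
  "covec i = (\<lambda>S. if S = {i} then 1 else 0)"

definition wedge :: "'a::comm_ring_1 form \<Rightarrow> 'a form \<Rightarrow> 'a form" (infixr "\<and>\<and>" 70) where
  "\<alpha> \<and>\<and> \<beta> = (\<lambda>S. \<Sum>T\<in>Pow S. shuffle_sign T (S - T) * \<alpha> T * \<beta> (S - T))"

definition contract :: "var \<Rightarrow> 'a::comm_ring_1 form \<Rightarrow> 'a form" where
  "contract i \<alpha> = (\<lambda>S. if i \<in> S then 0 else shuffle_sign {i} S * \<alpha> (insert i S))"

definition Lambda_\<omega> :: "'a::comm_ring_1 form \<Rightarrow> 'a form" where
  "Lambda_\<omega> \<alpha> = (\<lambda>S. \<Sum>j\<in>UNIV. contract (Inr j) (contract (Inl j) \<alpha>) S)"

definition omega :: "real form" where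
  "omega = (\<lambda>S. \<Sum>j\<in>UNIV. (covec (Inl j) \<and>\<and> covec (Inr j)) S)"

definition frame :: "var \<Rightarrow> (real^3) \<times> (real^3)" where
  "frame i = (case i of Inl j \<Rightarrow> (axis j 1, 0) | Inr j \<Rightarrow> (0, axis j 1))"

definition func_form :: "('w \<Rightarrow> 'a::zero) \<Rightarrow> 'w \<Rightarrow> 'a form" where
  "func_form f = (\<lambda>w S. if S = {} then f w else 0)"

definition ext_deriv ::
  "((real^3) \<times> (real^3) \<Rightarrow> 'a::real_normed_field form) \<Rightarrow> (real^3) \<times> (real^3) \<Rightarrow> 'a form" where
  "ext_deriv a w =
     (\<lambda>S. \<Sum>i\<in>S. shuffle_sign {i} (S - {i}) * dir_deriv (frame i) (\<lambda>w'. a w' (S - {i})) w)"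

text \<open>A covector at \<open>p\<close> is given by its components in every chart around \<open>p\<close>; these satisfy
  \<open>y = A\<^sup>T y'\<close> when \<open>x' = A x + b\<close>.\<close>
definition cotangent :: "'b::topological_space chart set \<Rightarrow> 'b \<Rightarrow> ('b chart \<Rightarrow> real^3) set" where
  "cotangent \<A> p = {\<xi>.
     (\<forall>c. c \<notin> charts_at \<A> p \<longrightarrow> \<xi> c = 0) \<and>
     (\<forall>c\<in>charts_at \<A> p. \<forall>c'\<in>charts_at \<A> p. \<forall>A.
        transition_at c c' p A \<longrightarrow> \<xi> c = transpose A *v \<xi> c')}"

definition dual_lattice :: "'b::topological_space chart set \<Rightarrow> 'b \<Rightarrow> ('b chart \<Rightarrow> real^3) set" where
  "dual_lattice \<A> p = {\<mu> \<in> cotangent \<A> p. \<forall>c\<in>charts_at \<A> p. \<forall>j. \<mu> c $ j \<in> \<int>}"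

definition lattice_coset ::
  "'b::topological_space chart set \<Rightarrow> 'b \<Rightarrow> ('b chart \<Rightarrow> real^3) \<Rightarrow> ('b chart \<Rightarrow> real^3) set" where
  "lattice_coset \<A> p \<xi> = {\<eta> \<in> cotangent \<A> p. (\<lambda>c. \<eta> c - \<xi> c) \<in> dual_lattice \<A> p}"

type_synonym 'b xpoint = "'b \<times> ('b chart \<Rightarrow> real^3) set"

text \<open>The total space of \<open>T\<^sup>*B\<close> modulo the fibrewise lattice \<open>\<Sum>\<^sub>j \<int> dx\<^sup>j\<close>.\<close>
definition Xhat :: "'b::topological_space chart set \<Rightarrow> 'b xpoint set" where
  "Xhat \<A> = {(p, lattice_coset \<A> p \<xi>) | p \<xi>. \<xi> \<in> cotangent \<A> p}"

text \<open>The covector at \<open>p\<close> with components \<open>y\<close> in the chart \<open>c\<close>.\<close>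
definition covector_at ::
  "'b::topological_space chart set \<Rightarrow> 'b chart \<Rightarrow> 'b \<Rightarrow> real^3 \<Rightarrow> 'b chart \<Rightarrow> real^3" where
  "covector_at \<A> c p y = (THE \<xi>. \<xi> \<in> cotangent \<A> p \<and> \<xi> c = y)"

text \<open>The local parametrisation \<open>cimg c \<times> \<real>\<^sup>3 \<rightarrow> Xhat \<A>\<close>, \<open>(x, y) \<mapsto>\<close> the class of \<open>\<Sum>\<^sub>j y\<^sub>j dx\<^sup>j\<close>.  It is
  periodic in \<open>y\<close>, and its local inverses are the coordinate charts of \<open>Xhat \<A>\<close>.\<close>
definition param ::
  "'b::topological_space chart set \<Rightarrow> 'b chart \<Rightarrow> (real^3) \<times> (real^3) \<Rightarrow> 'b xpoint" where
  "param \<A> c w = (let p = cinv c (fst w) in (p, lattice_coset \<A> p (covector_at \<A> c p (snd w))))"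

text \<open>The coordinates of a point; \<open>y\<close> is fixed only up to integers, by a choice of representative.\<close>
definition coords :: "'b chart \<Rightarrow> 'b xpoint \<Rightarrow> (real^3) \<times> (real^3)" where
  "coords c q = (cmap c (fst q), (SOME \<xi>. \<xi> \<in> snd q) c)"

text \<open>A differential form on \<open>Xhat \<A>\<close> is given by its coefficients at every point and for every
  affine chart around the base point, with respect to the coframe \<open>dx\<^sup>j, dy\<^sub>j\<close> of that chart.\<close>
type_synonym ('b, 'a) xform = "'b chart \<Rightarrow> 'b xpoint \<Rightarrow> 'a form"

definition d_Xhat ::
  "'b::topological_space chart set \<Rightarrow> ('b, real) xform \<Rightarrow> ('b, real) xform" where
  "d_Xhat \<A> \<alpha> c q = ext_deriv (\<lambda>w. \<alpha> c (param \<A> c w)) (coords c q)"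

definition Lambda_Xhat :: "('b, real) xform \<Rightarrow> ('b, real) xform" where
  "Lambda_Xhat \<alpha> c q = Lambda_\<omega> (\<alpha> c q)"

definition scale_Xhat :: "('b xpoint \<Rightarrow> real) \<Rightarrow> ('b, real) xform \<Rightarrow> ('b, real) xform" where
  "scale_Xhat f \<alpha> c q = (\<lambda>S. f q * \<alpha> c q S)"

definition potential :: "'b chart \<Rightarrow> 'b metric \<Rightarrow> 'b \<Rightarrow> real^3 \<Rightarrow> real" where
  "potential c g p = (SOME \<psi>. \<exists>V. local_potential c g p V \<psi>)"

text \<open>\<open>z\<^sub>j = x\<^sub>j + i y\<^sub>j\<close> near a point over \<open>p\<close>, with \<open>x\<^sub>j = \<partial>\<psi>/\<partial>x\<^sup>j\<close>.  The function depends on the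
  choice of the potential \<open>\<psi>\<close> by an additive constant only, so its differential does not.\<close>
definition z_coord :: "'b chart \<Rightarrow> 'b metric \<Rightarrow> 'b \<Rightarrow> 3 \<Rightarrow> (real^3) \<times> (real^3) \<Rightarrow> complex" where
  "z_coord c g p j w = Complex (partial j (potential c g p) (fst w)) (snd w $ j)"

definition dz :: "'b metric \<Rightarrow> 3 \<Rightarrow> ('b, complex) xform" where
  "dz g j c q = ext_deriv (func_form (z_coord c g (fst q) j)) (coords c q)"

definition Omega :: "'b metric \<Rightarrow> ('b, complex) xform" where
  "Omega g c q = dz g 1 c q \<and>\<and> dz g 2 c q \<and>\<and> dz g 3 c q"

definition phi :: "'b metric \<Rightarrow> ('b, real) xform" where
  "phi g c q = (\<lambda>S. Re (Omega g c q S))"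

definition phi_hat :: "'b metric \<Rightarrow> ('b, real) xform" where
  "phi_hat g c q = (\<lambda>S. Im (Omega g c q S))"

text \<open>\<open>\<phi> \<and> \<phi>' = |\<phi>|\<^sup>2 \<omega>\<^sup>3/3!\<close> with \<open>\<phi>'\<close> the imaginary part of \<open>Omega\<close>; the value is the same in
  all charts around the base point.\<close>
definition norm_sq_phi :: "'b chart set \<Rightarrow> 'b metric \<Rightarrow> 'b xpoint \<Rightarrow> real" where
  "norm_sq_phi \<A> g q = (THE r. \<forall>c\<in>charts_at \<A> (fst q).
     phi g c q \<and>\<and> phi_hat g c q = (\<lambda>S. r * ((omega \<and>\<and> omega \<and>\<and> omega) S / fact 3)))"

end

theory Submission
  imports Defs
begin

text \<open>In an affine chart, \<open>dz\<^sub>j = \<Sum>\<^sub>k g\<^sub>k\<^sub>j dx\<^sup>k + i dy\<^sub>j\<close>, so the coefficients of \<open>\<Omega>\<close> are, up to sign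
and powers of \<open>i\<close>, the minors of the matrix \<open>g\<close>: its determinant for \<open>dx\<^sup>1 dx\<^sup>2 dx\<^sup>3\<close>, its cofactors
for two \<open>dx\<close> and one \<open>dy\<close>, its entries for one \<open>dx\<close> and two \<open>dy\<close>, and \<open>1\<close> for
\<open>dy\<^sub>1 dy\<^sub>2 dy\<^sub>3\<close>.  The number of \<open>dy\<close> decides between the real part \<open>\<phi>\<close> (even: determinant and
entries) and the imaginary part \<open>\<phi>'\<close> (odd: cofactors and the constant \<open>-1\<close>).  Laplace
expansion then gives \<open>\<phi> \<and> \<phi>' = 4 det g \<omega>\<^sup>3/3!\<close> (lemma \<open>phi_wedge_phi_hat\<close>), so that
\<open>log |\<phi>|\<^sup>2\<close> and \<open>log det g\<close> differ by the constant \<open>log 4\<close>.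

The two summands of \<open>\<phi>'\<close> produce the two summands of \<open>\<partial>\<^sub>t \<phi>\<close>.  Every coefficient depends on
the base point only, so \<open>d\<close> differentiates in the directions \<open>x\<^sup>k\<close> alone, adding one
\<open>dx\<close>, while \<open>\<Lambda>\<close> removes one \<open>dx\<close> and one \<open>dy\<close>.  For an arbitrary function \<open>f\<close> on the base
(lemma \<open>d_Lambda_d_scaled_phi_hat\<close>):

\<^item> \<open>- f dy\<^sub>1 dy\<^sub>2 dy\<^sub>3\<close> is sent by \<open>\<Lambda> d\<close> to \<open>- \<Sum>\<^sub>c \<partial>\<^sub>cf \<iota>\<^sub>c (dy\<^sub>1 dy\<^sub>2 dy\<^sub>3)\<close>, with \<open>\<iota>\<^sub>c\<close> the contraction
  by \<open>\<partial>/\<partial>y\<^sub>c\<close>, and \<open>d\<close> of this is the variation of the \<open>dx dy dy\<close> part of \<open>\<phi>\<close> when the entries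
  of \<open>g\<close> vary by \<open>\<partial>\<^sub>k\<partial>\<^sub>cf\<close>;

\<^item> the cofactor part is sent by \<open>d \<Lambda> d\<close> to \<open>\<Sum>\<^sub>k\<^sub>,\<^sub>c \<partial>\<^sub>k\<partial>\<^sub>cf C\<^sub>k\<^sub>c dx\<^sup>1 dx\<^sup>2 dx\<^sup>3\<close>, with \<open>C\<close> the cofactor matrix, and
  this is the variation of \<open>det g\<close> for the same variation of \<open>g\<close>.

First derivatives of \<open>C\<close> would also occur in the second item.  They cancel because the
cofactor matrix of a Hessian is divergence free (lemma \<open>cof_divergence_free\<close>), which rests on
the symmetry of third derivatives of the potential.  The flow says that \<open>g\<close> varies by \<open>1/2 \<partial>\<^sub>k\<partial>\<^sub>c log det g\<close>, so
\<open>f = log |\<phi>|\<^sup>2\<close> gives the theorem.\<close>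

section \<open>Directional derivatives and their symmetry\<close>

lemma dir_deriv_eqI:
  assumes "(f has_derivative f') (at x)"
  shows "dir_deriv v f x = f' v"
  using frechet_derivative_at[OF assms] by (simp add: dir_deriv_def)

lemma dir_deriv_works:
  assumes "f differentiable at x"
  shows "(f has_derivative (\<lambda>v. dir_deriv v f x)) (at x)"
  using assms unfolding frechet_derivative_works dir_deriv_def .

text \<open>The equality needs no differentiability: \<open>f\<close> and \<open>h\<close> have the same derivatives at \<open>x\<close>, if any, and
\<open>dir_deriv\<close> is a choice that depends only on which maps are derivatives.\<close>
lemma dir_deriv_cong:
  assumes "open W" "x \<in> W" and eq: "\<And>y. y \<in> W \<Longrightarrow> f y = h y"
  shows "dir_deriv v f x = dir_deriv v h x"
proof -
  have "(f has_derivative f') (at x) \<longleftrightarrow> (h has_derivative f') (at x)" for f'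
    using has_derivative_transform_within_open[of _ f' x UNIV W] assms by metis
  then show ?thesis
    by (simp add: dir_deriv_def frechet_derivative_def)
qed

lemma differentiable_cong_open:
  assumes "open W" "x \<in> W" and eq: "\<And>y. y \<in> W \<Longrightarrow> f y = h y"
  shows "f differentiable at x \<longleftrightarrow> h differentiable at x"
  using has_derivative_transform_within_open[of _ _ x UNIV W] assms unfolding differentiable_def by metis

lemma dir_deriv_const [simp]: "dir_deriv v (\<lambda>x. c) = (\<lambda>x. 0)"
  by (simp add: dir_deriv_def fun_eq_iff)

lemma
  fixes f h :: "'a::real_normed_vector \<Rightarrow> real"
  assumes "f differentiable at x" "h differentiable at x"
  shows dir_deriv_add: "dir_deriv v (\<lambda>x. f x + h x) x = dir_deriv v f x + dir_deriv v h x"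
    and dir_deriv_diff: "dir_deriv v (\<lambda>x. f x - h x) x = dir_deriv v f x - dir_deriv v h x"
    and dir_deriv_mult: "dir_deriv v (\<lambda>x. f x * h x) x = f x * dir_deriv v h x + dir_deriv v f x * h x"
  by (rule dir_deriv_eqI; use assms[THEN dir_deriv_works] in \<open>auto intro!: derivative_eq_intros\<close>)+

lemma dir_deriv_cmult:
  fixes f :: "'a::real_normed_vector \<Rightarrow> real"
  assumes "f differentiable at x"
  shows "dir_deriv v (\<lambda>x. a * f x) x = a * dir_deriv v f x"
  using dir_deriv_mult[OF differentiable_const assms, of v a] by simp

lemma dir_deriv_sum:
  fixes f :: "'i \<Rightarrow> 'a::real_normed_vector \<Rightarrow> real"
  assumes "\<And>i. i \<in> J \<Longrightarrow> f i differentiable at x"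
  shows "dir_deriv v (\<lambda>x. \<Sum>i\<in>J. f i x) x = (\<Sum>i\<in>J. dir_deriv v (f i) x)"
  by (rule dir_deriv_eqI) (use assms in \<open>auto intro!: has_derivative_sum dir_deriv_works\<close>)

lemma dir_deriv_ln:
  fixes f :: "'a::real_normed_vector \<Rightarrow> real"
  assumes "f differentiable at x" "f x > 0"
  shows "dir_deriv v (\<lambda>x. ln (f x)) x = dir_deriv v f x / f x"
    and "(\<lambda>x. ln (f x)) differentiable at x"
proof -
  have "((\<lambda>x. ln (f x)) has_derivative (\<lambda>v. dir_deriv v f x / f x)) (at x)"
    using dir_deriv_works[OF assms(1)] assms(2)
    by (auto intro!: derivative_eq_intros simp: divide_inverse)
  then show "dir_deriv v (\<lambda>x. ln (f x)) x = dir_deriv v f x / f x"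
    and "(\<lambda>x. ln (f x)) differentiable at x"
    by (auto intro: dir_deriv_eqI differentiableI)
qed

lemma sum_differentiable:
  fixes f :: "'i \<Rightarrow> 'a::real_normed_vector \<Rightarrow> real"
  assumes "\<And>i. i \<in> J \<Longrightarrow> f i differentiable at x"
  shows "(\<lambda>x. \<Sum>i\<in>J. f i x) differentiable at x"
  using assms by (induction J rule: infinite_finite_induct) auto

text \<open>The regularity that the second-order operator \<open>d \<Lambda> d\<close> asks of its coefficients; with
explicit first derivatives at hand, it passes to products and logarithms by the usual rules.\<close>
definition twice_diff_on :: "'a::real_normed_vector set \<Rightarrow> ('a \<Rightarrow> real) \<Rightarrow> bool" where
  "twice_diff_on U f \<longleftrightarrow> (\<forall>x\<in>U. f differentiable at x \<and> (\<forall>v. dir_deriv v f differentiable at x))"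

lemma twice_diff_onD:
  assumes "twice_diff_on U f" "x \<in> U"
  shows "f differentiable at x" "dir_deriv v f differentiable at x"
  using assms by (auto simp: twice_diff_on_def)

lemma twice_diff_onI:
  assumes "open U" and "\<And>x. x \<in> U \<Longrightarrow> f differentiable at x"
    and "\<And>x v. x \<in> U \<Longrightarrow> dir_deriv v f x = f' v x"
    and "\<And>x v. x \<in> U \<Longrightarrow> f' v differentiable at x"
  shows "twice_diff_on U f"
  unfolding twice_diff_on_def
proof (intro ballI conjI allI assms(2))
  fix x v assume "x \<in> U"
  then show "dir_deriv v f differentiable at x"
    using differentiable_cong_open[OF assms(1), of x "dir_deriv v f" "f' v"] assms(3,4) by auto
qed

lemma twice_diff_on_const [simp]: "twice_diff_on U (\<lambda>x. c)"
  by (simp add: twice_diff_on_def)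

lemma
  assumes "open U" "twice_diff_on U f" "twice_diff_on U h"
  shows twice_diff_on_add: "twice_diff_on U (\<lambda>x. f x + h x)"
    and twice_diff_on_diff: "twice_diff_on U (\<lambda>x. f x - h x)"
    and twice_diff_on_mult: "twice_diff_on U (\<lambda>x. f x * h x)"
proof -
  note D = twice_diff_onD[OF assms(2)] twice_diff_onD[OF assms(3)]
  show "twice_diff_on U (\<lambda>x. f x + h x)"
    by (rule twice_diff_onI[OF assms(1)], use D in simp, rule dir_deriv_add) (use D in simp_all)
  show "twice_diff_on U (\<lambda>x. f x - h x)"
    by (rule twice_diff_onI[OF assms(1)], use D in simp, rule dir_deriv_diff) (use D in simp_all)
  show "twice_diff_on U (\<lambda>x. f x * h x)"
    by (rule twice_diff_onI[OF assms(1)], use D in simp, rule dir_deriv_mult) (use D in simp_all)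
qed

lemma twice_diff_on_ln:
  assumes "open U" "twice_diff_on U f" "\<And>x. x \<in> U \<Longrightarrow> f x > 0"
  shows "twice_diff_on U (\<lambda>x. ln (f x))"
proof (rule twice_diff_onI[OF assms(1)])
  fix x v assume x: "x \<in> U"
  note D = twice_diff_onD[OF assms(2) x]
  show "(\<lambda>x. ln (f x)) differentiable at x" "dir_deriv v (\<lambda>x. ln (f x)) x = dir_deriv v f x / f x"
    using dir_deriv_ln[OF D(1) assms(3)[OF x]] by auto
  show "(\<lambda>x. dir_deriv v f x / f x) differentiable at x"
    using D assms(3)[OF x] by (intro differentiable_divide) auto
qed

lemma smooth_on_dir_deriv:
  assumes "open S" "smooth_on S f"
  shows "smooth_on S (dir_deriv v f)"
  unfolding smooth_on_def
proof
  fix x assume x: "x \<in> S"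
  then obtain W h where W: "open W" "x \<in> W" "\<And>k. Ck_on k W h" "\<And>w. w \<in> W \<inter> S \<Longrightarrow> f w = h w"
    using assms(2) unfolding smooth_on_def by metis
  show "\<exists>W h. open W \<and> x \<in> W \<and> (\<forall>k. Ck_on k W h) \<and> (\<forall>w\<in>W \<inter> S. dir_deriv v f w = h w)"
  proof (intro exI conjI allI ballI)
    show "open W" "x \<in> W" by (fact W)+
    show "Ck_on k W (dir_deriv v h)" for k
      using W(3)[of "Suc k"] by auto
    show "dir_deriv v f w = dir_deriv v h w" if "w \<in> W \<inter> S" for w
      using that W(1,4) assms(1) by (intro dir_deriv_cong[of "W \<inter> S"]) auto
  qed
qed

lemma smooth_on_differentiable:
  assumes "open S" "smooth_on S f" "x \<in> S"
  shows "f differentiable at x"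
proof -
  obtain W h where W: "open W" "x \<in> W" "\<And>k. Ck_on k W h" "\<And>w. w \<in> W \<inter> S \<Longrightarrow> f w = h w"
    using assms(2,3) unfolding smooth_on_def by metis
  have "h differentiable at x"
    using W(2) W(3)[of "Suc 0"] by auto
  then show ?thesis
    using differentiable_cong_open[of "W \<inter> S" x f h] W assms by auto
qed

lemma smooth_on_twice_diff_on:
  assumes "open S" "smooth_on S f"
  shows "twice_diff_on S f"
  using assms smooth_on_differentiable smooth_on_dir_deriv unfolding twice_diff_on_def by metis

text \<open>The mean value theorem, first in the direction \<open>v\<close> for the difference in the direction \<open>w\<close>, then in
the direction \<open>w\<close>.  The left-hand side of the equation is symmetric in \<open>v\<close> and \<open>w\<close>, which is the
reason why mixed derivatives agree.\<close>
lemma second_difference_mean_value: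
  fixes f :: "'a::real_normed_vector \<Rightarrow> real"
  assumes U: "twice_diff_on U f" and h: "h > 0"
    and sub: "\<And>a b. 0 \<le> a \<Longrightarrow> a \<le> h \<Longrightarrow> 0 \<le> b \<Longrightarrow> b \<le> h \<Longrightarrow> x + a *\<^sub>R v + b *\<^sub>R w \<in> U"
  obtains a b where "0 \<le> a" "a \<le> h" "0 \<le> b" "b \<le> h"
    "f (x + h *\<^sub>R v + h *\<^sub>R w) - f (x + h *\<^sub>R v) - f (x + h *\<^sub>R w) + f x
       = h * h * dir_deriv w (dir_deriv v f) (x + a *\<^sub>R v + b *\<^sub>R w)"
proof -
  have line: "((\<lambda>s. F (y + s *\<^sub>R z)) has_derivative (\<lambda>r. r * dir_deriv z F (y + s *\<^sub>R z))) (at s)"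
    if F: "F differentiable at (y + s *\<^sub>R z)" for F :: "'a \<Rightarrow> real" and y z s
  proof -
    interpret linear "\<lambda>v. dir_deriv v F (y + s *\<^sub>R z)"
      using dir_deriv_works[OF F] has_derivative_bounded_linear bounded_linear.linear by blast
    have "((\<lambda>s. y + s *\<^sub>R z) has_derivative (\<lambda>r. r *\<^sub>R z)) (at s)"
      by (auto intro!: derivative_eq_intros)
    from has_derivative_compose[OF this dir_deriv_works[OF F]] show ?thesis
      by (simp add: scale)
  qed
  define p where "p s = f (x + h *\<^sub>R w + s *\<^sub>R v) - f (x + s *\<^sub>R v)" for s
  have "(p has_derivative
      (\<lambda>r. r * (dir_deriv v f (x + h *\<^sub>R w + s *\<^sub>R v) - dir_deriv v f (x + s *\<^sub>R v)))) (at s within {0..h})"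
    if "0 \<le> s" "s \<le> h" for s
    unfolding p_def right_diff_distrib
    using that h sub[of s h] sub[of s 0]
    by (intro has_derivative_diff has_derivative_at_withinI[OF line] twice_diff_onD(1)[OF U])
      (auto simp: algebra_simps)
  from mvt_simple[OF h this] obtain a where a: "0 < a" "a < h"
    and pa: "p h - p 0 = h * (dir_deriv v f (x + h *\<^sub>R w + a *\<^sub>R v) - dir_deriv v f (x + a *\<^sub>R v))"
    by auto
  have "((\<lambda>s. dir_deriv v f (x + a *\<^sub>R v + s *\<^sub>R w)) has_derivative
      (\<lambda>r. r * dir_deriv w (dir_deriv v f) (x + a *\<^sub>R v + s *\<^sub>R w))) (at s within {0..h})"
    if "0 \<le> s" "s \<le> h" for s
    using that a sub[of a s]
    by (intro has_derivative_at_withinI[OF line] twice_diff_onD(2)[OF U]) auto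
  from mvt_simple[OF h this] obtain b where b: "0 < b" "b < h"
    and qb: "dir_deriv v f (x + a *\<^sub>R v + h *\<^sub>R w) - dir_deriv v f (x + a *\<^sub>R v)
      = h * dir_deriv w (dir_deriv v f) (x + a *\<^sub>R v + b *\<^sub>R w)"
    by auto
  show thesis
    by (rule that[of a b]) (use a b pa qb in \<open>auto simp: p_def algebra_simps\<close>)
qed

text \<open>Both mixed derivatives are, at points arbitrarily close to \<open>x\<close>, the same second difference
divided by \<open>h\<^sup>2\<close>; continuity carries the equality to \<open>x\<close>.\<close>
lemma dir_deriv_commute:
  fixes f :: "'a::real_normed_vector \<Rightarrow> real"
  assumes "open U" "x \<in> U" and U: "twice_diff_on U f"
    and cont: "isCont (dir_deriv w (dir_deriv v f)) x" "isCont (dir_deriv v (dir_deriv w f)) x"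
  shows "dir_deriv v (dir_deriv w f) x = dir_deriv w (dir_deriv v f) x"
proof (rule ccontr)
  let ?A = "dir_deriv w (dir_deriv v f)" and ?B = "dir_deriv v (dir_deriv w f)"
  assume ne: "?B x \<noteq> ?A x"
  define e where "e = dist (?A x) (?B x) / 2"
  have e: "e > 0" using ne by (simp add: e_def)
  obtain d1 where d1: "d1 > 0" "\<And>y. dist y x < d1 \<Longrightarrow> dist (?A y) (?A x) < e"
    using cont(1) e unfolding continuous_at_eps_delta by (metis dist_norm)
  obtain d2 where d2: "d2 > 0" "\<And>y. dist y x < d2 \<Longrightarrow> dist (?B y) (?B x) < e"
    using cont(2) e unfolding continuous_at_eps_delta by (metis dist_norm)
  obtain d3 where d3: "d3 > 0" "ball x d3 \<subseteq> U"
    using assms(1,2) open_contains_ball by blast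
  define d where "d = min d1 (min d2 d3)"
  \<comment> \<open>With this step the parallelogram spanned by \<open>h v\<close> and \<open>h w\<close> lies within distance \<open>d\<close> of \<open>x\<close>.\<close>
  define h where "h = d / (norm v + norm w + 1)"
  have d: "d > 0" using d1 d2 d3 by (simp add: d_def)
  have pos: "norm v + norm w + 1 > 0" by (smt (verit) norm_ge_zero)
  have h: "h > 0" using d pos by (simp add: h_def)
  have near: "dist (x + a *\<^sub>R v + b *\<^sub>R w) x < d" if "0 \<le> a" "a \<le> h" "0 \<le> b" "b \<le> h" for a b
  proof -
    have "dist (x + a *\<^sub>R v + b *\<^sub>R w) x \<le> a * norm v + b * norm w"
      using norm_triangle_ineq[of "a *\<^sub>R v" "b *\<^sub>R w"] that by (simp add: dist_norm algebra_simps)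
    also have "\<dots> \<le> h * norm v + h * norm w"
      using that by (intro add_mono mult_right_mono) auto
    also have "\<dots> < h * (norm v + norm w + 1)"
      using h by (simp add: algebra_simps)
    also have "\<dots> = d" using pos by (simp add: h_def)
    finally show ?thesis .
  qed
  have sub: "x + a *\<^sub>R v + b *\<^sub>R w \<in> U" if "0 \<le> a" "a \<le> h" "0 \<le> b" "b \<le> h" for a b
    using near[OF that] d3 by (auto simp: d_def dist_commute)
  obtain a b where ab: "0 \<le> a" "a \<le> h" "0 \<le> b" "b \<le> h"
    and A: "f (x + h *\<^sub>R v + h *\<^sub>R w) - f (x + h *\<^sub>R v) - f (x + h *\<^sub>R w) + f x
       = h * h * ?A (x + a *\<^sub>R v + b *\<^sub>R w)"
    using second_difference_mean_value[OF U h, of x v w] sub by blast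
  have "x + a *\<^sub>R w + b *\<^sub>R v \<in> U" if "0 \<le> a" "a \<le> h" "0 \<le> b" "b \<le> h" for a b
    using sub[of b a] that by (simp add: algebra_simps)
  then obtain a' b' where ab': "0 \<le> a'" "a' \<le> h" "0 \<le> b'" "b' \<le> h"
    and B: "f (x + h *\<^sub>R w + h *\<^sub>R v) - f (x + h *\<^sub>R w) - f (x + h *\<^sub>R v) + f x
       = h * h * ?B (x + a' *\<^sub>R w + b' *\<^sub>R v)"
    using second_difference_mean_value[OF U h, of x w v] by blast
  have "h * h * ?A (x + a *\<^sub>R v + b *\<^sub>R w) = h * h * ?B (x + b' *\<^sub>R v + a' *\<^sub>R w)"
    using A B by (simp add: algebra_simps)
  then have eq: "?A (x + a *\<^sub>R v + b *\<^sub>R w) = ?B (x + b' *\<^sub>R v + a' *\<^sub>R w)"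
    using h by simp
  have "dist (?A (x + a *\<^sub>R v + b *\<^sub>R w)) (?A x) < e"
    using near[OF ab] by (intro d1) (auto simp: d_def)
  moreover have "dist (?B (x + b' *\<^sub>R v + a' *\<^sub>R w)) (?B x) < e"
    using near[OF ab'(3,4,1,2)] by (intro d2) (auto simp: d_def)
  ultimately have "dist (?A x) (?B x) < 2 * e"
    unfolding eq by (metis dist_commute dist_triangle_half_r mult_2 field_sum_of_halves e_def)
  then show False by (simp add: e_def)
qed

lemma smooth_on_dir_deriv_commute:
  fixes f :: "'a::real_normed_vector \<Rightarrow> real"
  assumes "open U" "smooth_on U f" "x \<in> U"
  shows "dir_deriv v (dir_deriv w f) x = dir_deriv w (dir_deriv v f) x"
proof -
  have "isCont (dir_deriv a (dir_deriv b f)) x" for a b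
    by (intro differentiable_imp_continuous_within smooth_on_differentiable[OF assms(1) _ assms(3)]
      smooth_on_dir_deriv[OF assms(1)] assms(2))
  then show ?thesis
    by (intro dir_deriv_commute[OF assms(1,3) smooth_on_twice_diff_on[OF assms(1,2)]])
qed

section \<open>Wedge products of coefficient forms\<close>

text \<open>As a product over pairs the sign can be computed by rewriting on explicit finite sets.\<close>
lemma shuffle_sign_eq_prod:
  "(shuffle_sign S T :: 'a::comm_ring_1) = (\<Prod>i\<in>S. \<Prod>j\<in>T. if rank_var j < rank_var i then -1 else 1)"
proof -
  have fin: "finite A" for A :: "var set" by simp
  have "(\<Prod>i\<in>S. \<Prod>j\<in>T. if rank_var j < rank_var i then -1 else (1::'a))
      = (\<Prod>p\<in>S \<times> T. if rank_var (snd p) < rank_var (fst p) then -1 else 1)"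
    by (simp add: prod.cartesian_product case_prod_unfold)
  also have "\<dots> = (\<Prod>p\<in>{p \<in> S \<times> T. rank_var (snd p) < rank_var (fst p)}. -1)"
    by (rule prod.inter_filter[symmetric]) (simp add: fin)
  also have "{p \<in> S \<times> T. rank_var (snd p) < rank_var (fst p)}
      = {(i, j). i \<in> S \<and> j \<in> T \<and> rank_var j < rank_var i}"
    by auto
  finally show ?thesis by (simp add: shuffle_sign_def)
qed

lemma shuffle_sign_empty [simp]: "shuffle_sign S {} = 1" "shuffle_sign {} T = 1"
  by (simp_all add: shuffle_sign_eq_prod)

definition homogeneous :: "nat \<Rightarrow> 'a::zero form \<Rightarrow> bool" where
  "homogeneous p \<alpha> \<longleftrightarrow> (\<forall>S. \<alpha> S \<noteq> 0 \<longrightarrow> card S = p)"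

lemma homogeneousD: "homogeneous p \<alpha> \<Longrightarrow> card S \<noteq> p \<Longrightarrow> \<alpha> S = 0"
  by (auto simp: homogeneous_def)

lemma homogeneous_wedge:
  assumes "homogeneous p \<alpha>" "homogeneous q \<beta>"
  shows "homogeneous (p + q) (\<alpha> \<and>\<and> \<beta>)"
  unfolding homogeneous_def
proof (intro allI impI)
  fix S assume "(\<alpha> \<and>\<and> \<beta>) S \<noteq> 0"
  then obtain T where T: "T \<subseteq> S" "\<alpha> T \<noteq> 0" "\<beta> (S - T) \<noteq> 0"
    unfolding wedge_def by (metis (no_types, lifting) Pow_iff mult_zero_left mult_zero_right sum.neutral)
  have "card S = card T + card (S - T)"
    using T(1) by (simp add: card_Diff_subset card_mono)
  then show "card S = p + q"
    using T(2,3) assms by (auto simp: homogeneous_def)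
qed

lemma homogeneous_covec [simp]: "homogeneous (Suc 0) (covec i)"
  by (simp add: homogeneous_def covec_def)

lemma wedge_one_form:
  fixes \<alpha> \<beta> :: "'a::comm_ring_1 form"
  assumes "homogeneous 1 \<alpha>"
  shows "(\<alpha> \<and>\<and> \<beta>) S = (\<Sum>i\<in>S. shuffle_sign {i} (S - {i}) * \<alpha> {i} * \<beta> (S - {i}))"
proof -
  have "(\<alpha> \<and>\<and> \<beta>) S = (\<Sum>T\<in>(\<lambda>i. {i}) ` S. shuffle_sign T (S - T) * \<alpha> T * \<beta> (S - T))"
    unfolding wedge_def
  proof (rule sum.mono_neutral_right)
    show "\<forall>T\<in>Pow S - (\<lambda>i. {i}) ` S. shuffle_sign T (S - T) * \<alpha> T * \<beta> (S - T) = 0"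
    proof
      fix T assume T: "T \<in> Pow S - (\<lambda>i. {i}) ` S"
      then have "card T \<noteq> 1" by (auto simp: card_1_singleton_iff)
      then show "shuffle_sign T (S - T) * \<alpha> T * \<beta> (S - T) = 0"
        using homogeneousD[OF assms] by simp
    qed
  qed auto
  then show ?thesis by (simp add: sum.reindex)
qed

text \<open>The coefficient of a product of three covectors is a determinant, expanded here along the first
factor; the ranks enter because the coefficient refers to the sorted basis monomial.\<close>
lemma wedge_three_one_forms:
  fixes \<alpha> \<beta> \<gamma> :: "'a::comm_ring_1 form"
  assumes deg: "homogeneous 1 \<alpha>" "homogeneous 1 \<beta>" "homogeneous 1 \<gamma>"
    and r: "rank_var i < rank_var j" "rank_var j < rank_var k"
  shows "(\<alpha> \<and>\<and> \<beta> \<and>\<and> \<gamma>) {i, j, k}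
    = \<alpha> {i} * (\<beta> {j} * \<gamma> {k} - \<beta> {k} * \<gamma> {j})
    - \<alpha> {j} * (\<beta> {i} * \<gamma> {k} - \<beta> {k} * \<gamma> {i})
    + \<alpha> {k} * (\<beta> {i} * \<gamma> {j} - \<beta> {j} * \<gamma> {i})"
proof -
  have ne: "i \<noteq> j" "i \<noteq> k" "j \<noteq> k" "j \<noteq> i" "k \<noteq> i" "k \<noteq> j" using r by auto
  have [simp]: "rank_var i < rank_var k" "\<not> rank_var j < rank_var i" "\<not> rank_var k < rank_var j"
     "\<not> rank_var k < rank_var i" using r by auto
  have diffs: "{i, j, k} - {i} = {j, k}" "{i, j, k} - {j} = {i, k}" "{i, j, k} - {k} = {i, j}"
    "{a, b} - {a} = {b} - {a}" "{a, b} - {b} = {a} - {b}" for a b using ne by auto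
  show ?thesis
    using ne r
    by (simp add: wedge_one_form[OF deg(1)] wedge_one_form[OF deg(2)] diffs shuffle_sign_eq_prod algebra_simps)
qed

text \<open>A set of variables is written \<open>A <+> B\<close>, where \<open>A\<close> holds the indices of its \<open>dx\<close> and \<open>B\<close>
those of its \<open>dy\<close>.\<close>
lemma var_set_Plus: obtains A B where "S = (A <+> B :: var set)"
proof
  show "S = {k. Inl k \<in> S} <+> {k. Inr k \<in> S}"
    by (auto simp: Plus_def image_iff) (metis sum.exhaust)
qed

section \<open>The holomorphic volume form of a matrix\<close>

text \<open>The covector \<open>dz\<^sub>j\<close> for a metric with matrix \<open>m\<close>.  The entry is \<open>m\<^sub>k\<^sub>j\<close> and not \<open>m\<^sub>j\<^sub>k\<close> because
the coefficient of \<open>dx\<^sup>k\<close> in \<open>dx\<^sub>j\<close> is \<open>\<partial>\<^sub>k\<partial>\<^sub>j\<close> of the potential, in this order.\<close>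
definition dz_row :: "real^3^3 \<Rightarrow> 3 \<Rightarrow> complex form" where
  "dz_row m j = (\<lambda>S. (\<Sum>k\<in>UNIV. of_real (m $ k $ j) * covec (Inl k) S) + \<i> * covec (Inr j) S)"

definition Omega_mat :: "real^3^3 \<Rightarrow> complex form" where
  "Omega_mat m = dz_row m 1 \<and>\<and> dz_row m 2 \<and>\<and> dz_row m 3"

text \<open>Indices of the type \<open>3\<close> are taken modulo three, and in cyclic order a cofactor of a
\<open>3 \<times> 3\<close> matrix carries no sign.\<close>
definition cof :: "real^3^3 \<Rightarrow> 3 \<Rightarrow> 3 \<Rightarrow> real" where
  "cof m j k = m $ (j + 1) $ (k + 1) * m $ (j + 2) $ (k + 2)
             - m $ (j + 1) $ (k + 2) * m $ (j + 2) $ (k + 1)"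

text \<open>The sign of moving \<open>dx\<^sup>k\<close> in front of the other two \<open>dx\<close>, which converts between the
cyclic order used in \<open>cof\<close> and the sorted order of basis monomials.\<close>
definition sgn3 :: "3 \<Rightarrow> real" where "sgn3 k = (if k = 2 then -1 else 1)"

text \<open>Rewriting adds numerals before it reduces them modulo three.\<close>
lemma numeral_mod_3 [simp]:
  "(4::3) = 1" "(5::3) = 2"
  by simp_all

lemma rank_var_simps [simp]:
  "rank_var (Inl 1) = 1" "rank_var (Inl 2) = 2" "rank_var (Inl 3) = 3"
  "rank_var (Inr 1) = 4" "rank_var (Inr 2) = 5" "rank_var (Inr 3) = 6"
  by (simp_all add: rank_var_def num3_def)

lemma Compl_3: "- {1::3} = {2,3}" "- {2::3} = {1,3}" "- {3::3} = {1,2}"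
  using UNIV_3 by auto

lemma homogeneous_dz_row: "homogeneous 1 (dz_row m j)"
  unfolding homogeneous_def
proof (intro allI impI)
  fix S assume "dz_row m j S \<noteq> 0"
  moreover have "dz_row m j S = 0" if "\<nexists>i. S = {i}"
    using that by (simp add: dz_row_def covec_def)
  ultimately obtain i where "S = {i}" by blast
  then show "card S = 1" by simp
qed

lemma dz_row_simps [simp]:
  "dz_row m j {Inl k} = of_real (m $ k $ j)"
  "dz_row m j {Inr k} = (if k = j then \<i> else 0)"
  by (auto simp: dz_row_def covec_def if_distrib cong: if_cong)

lemma homogeneous_Omega_mat: "homogeneous 3 (Omega_mat m)"
  unfolding Omega_mat_def
  using homogeneous_wedge[OF homogeneous_dz_row homogeneous_wedge[OF homogeneous_dz_row homogeneous_dz_row]]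
  by (simp add: numeral_3_eq_3)

lemma Omega_mat_sorted:
  assumes "rank_var i < rank_var j" "rank_var j < rank_var k"
  shows "Omega_mat m {i, j, k}
    = dz_row m 1 {i} * (dz_row m 2 {j} * dz_row m 3 {k} - dz_row m 2 {k} * dz_row m 3 {j})
    - dz_row m 1 {j} * (dz_row m 2 {i} * dz_row m 3 {k} - dz_row m 2 {k} * dz_row m 3 {i})
    + dz_row m 1 {k} * (dz_row m 2 {i} * dz_row m 3 {j} - dz_row m 2 {j} * dz_row m 3 {i})"
  unfolding Omega_mat_def by (intro wedge_three_one_forms homogeneous_dz_row assms)

lemma Plus_insert: "insert a A <+> B = insert (Inl a) (A <+> B)" "{} <+> insert b B = insert (Inr b) ({} <+> B)"
  "{} <+> {} = {}"
  by (auto simp: Plus_def)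

text \<open>The four types of coefficients of \<open>\<Omega>\<close>, each an instance of the expansion above.  A name such as
\<open>XXY\<close> lists the \<open>dx\<close> and \<open>dy\<close> of the monomial.\<close>
lemma Omega_mat_XXX: "Omega_mat m (UNIV <+> {}) = of_real (det m)"
  by (simp add: UNIV_3 Plus_insert Omega_mat_sorted det_3 algebra_simps)

lemma Omega_mat_YYY: "Omega_mat m ({} <+> UNIV) = - \<i>"
proof -
  have "Omega_mat m {Inr 1, Inr 2, Inr 3} = - \<i>"
    by (subst Omega_mat_sorted) simp_all
  then show ?thesis by (simp only: UNIV_3 Plus_insert)
qed

lemma Omega_mat_XYY: "Omega_mat m ({k} <+> - {c}) = - of_real (sgn3 c * m $ k $ c)"
  using exhaust_3[of k] exhaust_3[of c]
  by (elim disjE; simp add: Compl_3 Plus_insert Omega_mat_sorted sgn3_def complex_eq_iff)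

lemma Omega_mat_XXY: "Omega_mat m (- {k} <+> {c}) = \<i> * of_real (sgn3 k * cof m k c)"
  using exhaust_3[of k] exhaust_3[of c]
  by (elim disjE; simp add: Compl_3 Plus_insert Omega_mat_sorted sgn3_def cof_def complex_eq_iff)

text \<open>Two of three indices form the complement of the remaining one, so two indices \<open>k\<close> and \<open>c\<close> suffice to
name each monomial of degree three.\<close>
lemma var_triple_cases:
  assumes "card (S :: var set) = 3"
  obtains "S = UNIV <+> {}" | k c where "S = - {k} <+> {c}" | k c where "S = {k} <+> - {c}" | "S = {} <+> UNIV"
proof -
  have top: "C = UNIV" if "card C = 3" for C :: "3 set"
    using that by (intro card_subset_eq) simp_all
  have co: "\<exists>k. C = - {k}" if "card C = 2" for C :: "3 set"
  proof -
    have "card (- C) = 1" using that by (simp add: Compl_eq_Diff_UNIV card_Diff_subset)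
    then show ?thesis by (metis card_1_singletonE double_complement)
  qed
  obtain A B where S: "S = A <+> B" by (rule var_set_Plus)
  have "card A + card B = 3" using assms by (simp add: S card_Plus)
  then consider "card A = 3" "card B = 0" | "card A = 2" "card B = 1" | "card A = 1" "card B = 2"
    | "card A = 0" "card B = 3" by linarith
  then show thesis
  proof cases
    case 1
    then show thesis using top[of A] that(1) S by simp
  next
    case 2
    obtain k where "A = - {k}" using co 2 by blast
    moreover obtain c where "B = {c}" using 2 by (auto simp: card_1_singleton_iff)
    ultimately show thesis using that(2) S by blast
  next
    case 3
    obtain c where "B = - {c}" using co 3 by blast
    moreover obtain k where "A = {k}" using 3 by (auto simp: card_1_singleton_iff)
    ultimately show thesis using that(3) S by blast
  next
    case 4
    then show thesis using top[of B] that(4) S by simp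
  qed
qed

definition phi_mat :: "real^3^3 \<Rightarrow> real form" where
  "phi_mat m S = Re (Omega_mat m S)"

definition phi_hat_mat :: "real^3^3 \<Rightarrow> real form" where
  "phi_hat_mat m S = Im (Omega_mat m S)"

lemma homogeneous_phi_mat: "homogeneous 3 (phi_mat m)"
  and homogeneous_phi_hat_mat: "homogeneous 3 (phi_hat_mat m)"
  using homogeneous_Omega_mat[of m] unfolding homogeneous_def phi_mat_def phi_hat_mat_def
  by (metis zero_complex.simps)+

lemma phi_mat_simps [simp]:
  "phi_mat m (UNIV <+> {}) = det m" "phi_mat m ({} <+> UNIV) = 0"
  "phi_mat m ({k} <+> - {c}) = - (sgn3 c * m $ k $ c)" "phi_mat m (- {k} <+> {c}) = 0"
  by (simp_all add: phi_mat_def Omega_mat_XXX Omega_mat_YYY Omega_mat_XYY Omega_mat_XXY)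

lemma phi_hat_mat_simps [simp]:
  "phi_hat_mat m (UNIV <+> {}) = 0" "phi_hat_mat m ({} <+> UNIV) = -1"
  "phi_hat_mat m ({k} <+> - {c}) = 0" "phi_hat_mat m (- {k} <+> {c}) = sgn3 k * cof m k c"
  by (simp_all add: phi_hat_mat_def Omega_mat_XXX Omega_mat_YYY Omega_mat_XYY Omega_mat_XXY)

section \<open>The norm of the real part\<close>

lemma Compl_Plus: "- (A <+> B) = - A <+> - B"
proof (rule set_eqI)
  show "x \<in> - (A <+> B) \<longleftrightarrow> x \<in> - A <+> - B" for x
    by (cases x) auto
qed

lemma Plus_eq_iff: "A <+> B = C <+> D \<longleftrightarrow> A = C \<and> B = D"
  by (auto simp: Plus_def set_eq_iff)

text \<open>The variable \<open>dx\<^sup>k\<close> passes the smaller \<open>dx\<close>, which gives \<open>sgn3 k\<close>.  The two \<open>dy\<close> pass two \<open>dx\<close> each,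
which gives no sign, and those above \<open>dy\<^sub>c\<close> pass it, which gives \<open>sgn3 c\<close>.\<close>
lemma shuffle_sign_XYY: "shuffle_sign ({k} <+> - {c}) (- {k} <+> {c}) = sgn3 k * sgn3 c"
  using exhaust_3[of k] exhaust_3[of c]
  by (elim disjE; simp add: Compl_3 Plus_insert shuffle_sign_eq_prod sgn3_def)

lemma shuffle_sign_XXX: "shuffle_sign (UNIV <+> {}) ({} <+> UNIV :: var set) = (1 :: 'a::comm_ring_1)"
proof -
  have "shuffle_sign {Inl 1, Inl 2, Inl 3} {Inr 1, Inr 2, Inr 3 :: var} = (1 :: 'a)"
    by (simp add: shuffle_sign_eq_prod)
  then show ?thesis by (simp only: UNIV_3 Plus_insert)
qed

text \<open>Laplace expansion along a column.\<close>
lemma det_cof: "(\<Sum>k\<in>UNIV. m $ k $ c * cof m k c) = det m"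
  using exhaust_3[of c] by (elim disjE; simp add: sum_3 cof_def det_3 algebra_simps)

text \<open>A summand of the wedge product survives only when the subset is \<open>dx\<^sup>1 dx\<^sup>2 dx\<^sup>3\<close> or a
\<open>dx\<^sup>k\<close> with two \<open>dy\<close>.  The first contributes \<open>- det m\<close>.  The nine others are the terms of the
Laplace expansions along the three columns and contribute \<open>- det m\<close> per column.\<close>
lemma phi_wedge_phi_hat_UNIV: "(phi_mat m \<and>\<and> phi_hat_mat m) UNIV = - 4 * det m"
proof -
  let ?f = "\<lambda>T. shuffle_sign T (- T) * phi_mat m T * phi_hat_mat m (- T)"
  let ?P = "\<lambda>(k, c). {k} <+> - {c} :: var set"
  have inj: "inj ?P" by (auto simp: inj_def Plus_eq_iff)
  have UNIV_ne: "UNIV \<noteq> {k}" for k :: 3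
  proof
    assume "UNIV = {k}"
    then have "card (UNIV :: 3 set) = 1" by (metis card_1_singleton_iff One_nat_def)
    then show False by simp
  qed
  have sgn: "sgn3 k * sgn3 k = 1" for k by (simp add: sgn3_def)
  have "(phi_mat m \<and>\<and> phi_hat_mat m) UNIV = (\<Sum>T\<in>UNIV. ?f T)"
    by (simp add: wedge_def Compl_eq_Diff_UNIV)
  also have "\<dots> = (\<Sum>T\<in>insert (UNIV <+> {}) (range ?P). ?f T)"
  proof (rule sum.mono_neutral_right)
    show "\<forall>T\<in>UNIV - insert (UNIV <+> {}) (range ?P). ?f T = 0"
    proof
      fix T assume T: "T \<in> UNIV - insert (UNIV <+> {}) (range ?P)"
      have "phi_mat m T = 0"
      proof (cases "card T = 3")
        case True
        then show ?thesis
          by (cases rule: var_triple_cases) (use T in \<open>auto\<close>)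
      qed (rule homogeneousD[OF homogeneous_phi_mat])
      then show "?f T = 0" by simp
    qed
  qed auto
  also have "\<dots> = ?f (UNIV <+> {}) + (\<Sum>T\<in>range ?P. ?f T)"
    using UNIV_ne by (intro sum.insert) (auto simp: Plus_eq_iff)
  also have "?f (UNIV <+> {}) = - det m"
    by (simp add: Compl_Plus shuffle_sign_XXX)
  also have "(\<Sum>T\<in>range ?P. ?f T) = (\<Sum>p\<in>UNIV. ?f (?P p))"
    using inj by (simp add: sum.reindex)
  also have "\<dots> = (\<Sum>(k, c)\<in>UNIV \<times> UNIV. - (m $ k $ c * cof m k c))"
  proof (rule sum.cong)
    fix p :: "3 \<times> 3"
    obtain k c where p: "p = (k, c)" by (cases p)
    have "sgn3 k * sgn3 c * - (sgn3 c * m $ k $ c) * (sgn3 k * cof m k c)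
        = - ((sgn3 k * sgn3 k) * (sgn3 c * sgn3 c) * (m $ k $ c * cof m k c))"
      by (simp add: algebra_simps)
    then show "?f (?P p) = (case p of (k, c) \<Rightarrow> - (m $ k $ c * cof m k c))"
      by (simp add: p Compl_Plus shuffle_sign_XYY sgn)
  qed auto
  also have "\<dots> = (\<Sum>k\<in>UNIV. \<Sum>c\<in>UNIV. - (m $ k $ c * cof m k c))"
    by (simp only: sum.cartesian_product)
  also have "\<dots> = (\<Sum>c\<in>UNIV. \<Sum>k\<in>UNIV. - (m $ k $ c * cof m k c))"
    by (rule sum.swap)
  also have "\<dots> = - 3 * det m"
    by (simp add: sum_negf det_cof)
  finally show ?thesis by simp
qed

definition xy_pair :: "3 \<Rightarrow> var set" where "xy_pair j = {Inl j, Inr j}"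

lemma omega_eq: "omega S = (\<Sum>j\<in>UNIV. if S = xy_pair j then 1 else 0)"
proof -
  have "(covec (Inl j) \<and>\<and> covec (Inr j)) S = (if S = xy_pair j then 1 else (0::real))" for j
  proof -
    have "shuffle_sign {Inl j} {Inr j} = (1::real)"
      using exhaust_3[of j] by (auto simp: shuffle_sign_eq_prod)
    moreover have "(covec (Inl j) \<and>\<and> covec (Inr j)) S
      = (\<Sum>i\<in>S. if i = Inl j then if S - {Inl j} = {Inr j} then shuffle_sign {Inl j} {Inr j} else 0 else (0::real))"
      unfolding wedge_one_form[of "covec (Inl j)", unfolded One_nat_def, OF homogeneous_covec]
      by (intro sum.cong) (auto simp: covec_def)
    ultimately show ?thesis
      by (auto simp: xy_pair_def)
  qed
  then show ?thesis by (simp add: omega_def)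
qed

lemma homogeneous_omega: "homogeneous 2 omega"
  unfolding homogeneous_def
proof (intro allI impI)
  fix S assume "omega S \<noteq> 0"
  then obtain j where "S = xy_pair j"
    unfolding omega_eq by (metis (mono_tags, lifting) sum.neutral)
  then show "card S = 2" by (simp add: xy_pair_def)
qed

lemma omega_wedge:
  "(omega \<and>\<and> \<beta>) S
    = (\<Sum>j\<in>UNIV. if xy_pair j \<subseteq> S then shuffle_sign (xy_pair j) (S - xy_pair j) * \<beta> (S - xy_pair j) else 0)"
proof -
  have "(omega \<and>\<and> \<beta>) S = (\<Sum>T\<in>Pow S. \<Sum>j\<in>UNIV.
      if T = xy_pair j then shuffle_sign (xy_pair j) (S - xy_pair j) * \<beta> (S - xy_pair j) else 0)"
    unfolding wedge_def omega_eq sum_distrib_left sum_distrib_right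
    by (intro sum.cong) auto
  also have "\<dots> = (\<Sum>j\<in>UNIV. \<Sum>T\<in>Pow S.
      if T = xy_pair j then shuffle_sign (xy_pair j) (S - xy_pair j) * \<beta> (S - xy_pair j) else 0)"
    by (rule sum.swap)
  finally show ?thesis by simp
qed

text \<open>The value is negative since sorting \<open>dx\<^sup>1 dy\<^sub>1 dx\<^sup>2 dy\<^sub>2 dx\<^sup>3 dy\<^sub>3\<close> into the order
\<open>dx\<^sup>1 dx\<^sup>2 dx\<^sup>3 dy\<^sub>1 dy\<^sub>2 dy\<^sub>3\<close> takes three transpositions.\<close>
lemma omega_cubed_UNIV: "(omega \<and>\<and> omega \<and>\<and> omega) UNIV = - 6"
proof -
  have U: "UNIV = {Inl 1, Inl 2, Inl 3, Inr 1, Inr 2, Inr 3 :: var}"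
    using UNIV_Plus_UNIV[where 'a=3 and 'b=3] by (simp only: UNIV_3 Plus_insert)
  show ?thesis
    by (simp add: omega_wedge omega_eq sum_3 xy_pair_def U insert_Diff_if shuffle_sign_eq_prod doubleton_eq_iff
      del: insert_UNIV)
qed

lemma phi_wedge_phi_hat:
  "phi_mat m \<and>\<and> phi_hat_mat m = (\<lambda>S. 4 * det m * ((omega \<and>\<and> omega \<and>\<and> omega) S / fact 3))"
proof
  fix S :: "var set"
  show "(phi_mat m \<and>\<and> phi_hat_mat m) S = 4 * det m * ((omega \<and>\<and> omega \<and>\<and> omega) S / fact 3)"
  proof (cases "S = UNIV")
    case True
    then show ?thesis
      by (simp add: phi_wedge_phi_hat_UNIV omega_cubed_UNIV fact_numeral)
  next
    case False
    then have "card S < card (UNIV :: var set)" by (intro psubset_card_mono) auto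
    also have "card (UNIV :: var set) = 6"
      using card_Plus[of "UNIV :: 3 set" "UNIV :: 3 set"] by simp
    finally have "card S \<noteq> 6" by simp
    then show ?thesis
      using homogeneousD[OF homogeneous_wedge[OF homogeneous_phi_mat homogeneous_phi_hat_mat], of S m m]
        homogeneousD[OF homogeneous_wedge[OF homogeneous_omega homogeneous_wedge[OF homogeneous_omega homogeneous_omega]], of S]
      by simp
  qed
qed

section \<open>Differential operators on fibre-invariant forms\<close>

text \<open>The exterior derivative of a form whose coefficients \<open>A\<close> are functions of \<open>x\<close> alone; the
summands for the variables \<open>y\<close> are derivatives along the zero vector.\<close>
definition base_deriv :: "(real^3 \<Rightarrow> real form) \<Rightarrow> real^3 \<Rightarrow> real form" where
  "base_deriv A u S
     = (\<Sum>i\<in>S. shuffle_sign {i} (S - {i}) * dir_deriv (fst (frame i)) (\<lambda>v. A v (S - {i})) u)"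

lemma frame_simps [simp]:
  "frame (Inl k) = (axis k 1, 0)" "frame (Inr k) = (0, axis k 1)"
  by (simp_all add: frame_def)

lemma dir_deriv_zero [simp]: "f differentiable at x \<Longrightarrow> dir_deriv 0 f x = 0"
  using linear_0[OF linear_frechet_derivative] by (simp add: dir_deriv_def)

lemma dir_deriv_comp_fst:
  assumes "f differentiable at (fst w)"
  shows "dir_deriv v (\<lambda>w. f (fst w)) w = dir_deriv (fst v) f (fst w)"
  by (rule dir_deriv_eqI[where f' = "\<lambda>v. dir_deriv (fst v) f (fst w)"])
    (rule has_derivative_compose[OF has_derivative_fst[OF has_derivative_ident] dir_deriv_works[OF assms]])

text \<open>The hypothesis on \<open>a\<close> is local in \<open>x\<close> because a form on the torus bundle is known in the
coordinates of a chart only above the image of that chart.\<close>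
lemma ext_deriv_fibre_invariant:
  assumes W: "open W" "fst w \<in> W" and eq: "\<And>v. fst v \<in> W \<Longrightarrow> a v = A (fst v)"
    and diff: "\<And>S. (\<lambda>u. A u S) differentiable at (fst w)"
  shows "ext_deriv a w = base_deriv A (fst w)"
proof
  fix S
  have "dir_deriv (frame i) (\<lambda>v. a v T) w = dir_deriv (fst (frame i)) (\<lambda>u. A u T) (fst w)" for i T
  proof -
    have "dir_deriv (frame i) (\<lambda>v. a v T) w = dir_deriv (frame i) (\<lambda>v. A (fst v) T) w"
      using W eq by (intro dir_deriv_cong[of "W \<times> UNIV"]) (auto simp: open_Times mem_Times_iff)
    also have "\<dots> = dir_deriv (fst (frame i)) (\<lambda>u. A u T) (fst w)"
      by (rule dir_deriv_comp_fst[OF diff])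
    finally show ?thesis .
  qed
  then show "ext_deriv a w S = base_deriv A (fst w) S"
    by (simp add: ext_deriv_def base_deriv_def)
qed

lemma base_deriv_Plus:
  assumes "\<And>T. (\<lambda>v. A v T) differentiable at u"
  shows "base_deriv A u (X <+> Y)
    = (\<Sum>k\<in>X. shuffle_sign {Inl k} ((X - {k}) <+> Y) * partial k (\<lambda>v. A v ((X - {k}) <+> Y)) u)"
proof -
  have [simp]: "X <+> Y - {Inl k} = (X - {k}) <+> Y" for k by auto
  show ?thesis
    by (simp add: base_deriv_def sum.Plus assms)
qed

lemma Lambda_omega_Plus:
  "Lambda_\<omega> \<alpha> (X <+> Y) = (\<Sum>j\<in>UNIV. if j \<in> X \<or> j \<in> Y then 0 else
     shuffle_sign {Inr j} (X <+> Y) * (shuffle_sign {Inl j} (X <+> insert j Y) * \<alpha> (insert j X <+> insert j Y)))"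
proof -
  have [simp]: "insert (Inr j) (X <+> Y) = X <+> insert j Y"
    "insert (Inl j) (X <+> insert j Y) = insert j X <+> insert j Y" for j by auto
  show ?thesis
    unfolding Lambda_\<omega>_def by (intro sum.cong) (auto simp: contract_def)
qed

lemma base_deriv_differentiable:
  assumes "\<And>T. twice_diff_on U (\<lambda>v. A v T)" "u \<in> U"
  shows "(\<lambda>v. base_deriv A v S) differentiable at u"
  unfolding base_deriv_def
  using twice_diff_onD(2)[OF assms(1) assms(2)]
  by (intro sum_differentiable differentiable_mult differentiable_const)

lemma Lambda_omega_differentiable:
  fixes A :: "'a::real_normed_vector \<Rightarrow> real form"
  assumes "\<And>T. (\<lambda>v. A v T) differentiable at u"
  shows "(\<lambda>v. Lambda_\<omega> (A v) S) differentiable at u"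
  unfolding Lambda_\<omega>_def contract_def
proof (intro sum_differentiable)
  fix j :: 3
  show "(\<lambda>v. if Inr j \<in> S then 0 else shuffle_sign {Inr j} S *
      (if Inl j \<in> insert (Inr j) S then 0
       else shuffle_sign {Inl j} (insert (Inr j) S) * A v (insert (Inl j) (insert (Inr j) S))))
      differentiable at u"
    by (cases "Inr j \<in> S"; cases "Inl j \<in> S") (simp_all add: assms)
qed

text \<open>Total degree together with a condition on the number of \<open>dy\<close>.  The condition is used with
parities: they separate \<open>\<phi>\<close> from \<open>\<phi>'\<close>, \<open>d\<close> keeps them and \<open>\<Lambda>\<close> exchanges them.\<close>
definition bigraded :: "nat \<Rightarrow> (nat \<Rightarrow> bool) \<Rightarrow> real form \<Rightarrow> bool" where
  "bigraded n Q \<alpha> \<longleftrightarrow> (\<forall>X Y. \<alpha> (X <+> Y) \<noteq> 0 \<longrightarrow> card X + card Y = n \<and> Q (card Y))"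

lemma bigraded_base_deriv:
  assumes A: "\<And>v. v \<in> U \<Longrightarrow> bigraded n Q (A v)" and U: "open U" "u \<in> U"
    and diff: "\<And>T. (\<lambda>v. A v T) differentiable at u"
  shows "bigraded (Suc n) Q (base_deriv A u)"
  unfolding bigraded_def
proof (intro allI impI)
  fix X Y assume "base_deriv A u (X <+> Y) \<noteq> 0"
  then obtain k where k: "k \<in> X" "partial k (\<lambda>v. A v ((X - {k}) <+> Y)) u \<noteq> 0"
    unfolding base_deriv_Plus[OF diff] by (metis (no_types, lifting) mult_zero_right sum.neutral)
  have "\<not> (\<forall>v\<in>U. A v ((X - {k}) <+> Y) = 0)"
    using dir_deriv_cong[OF U, of "\<lambda>v. A v ((X - {k}) <+> Y)" "\<lambda>_. 0" "axis k 1"] k(2) by auto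
  then have "card (X - {k}) + card Y = n \<and> Q (card Y)"
    using A unfolding bigraded_def by blast
  moreover have "card X = Suc (card (X - {k}))"
    using card.remove[OF _ k(1)] by simp
  ultimately show "card X + card Y = Suc n \<and> Q (card Y)" by simp
qed

lemma bigraded_Lambda_omega:
  assumes "bigraded (Suc (Suc n)) Q \<alpha>"
  shows "bigraded n (\<lambda>b. Q (Suc b)) (Lambda_\<omega> \<alpha>)"
  unfolding bigraded_def
proof (intro allI impI)
  fix X Y assume "Lambda_\<omega> \<alpha> (X <+> Y) \<noteq> 0"
  then obtain j where j: "j \<notin> X" "j \<notin> Y" "\<alpha> (insert j X <+> insert j Y) \<noteq> 0"
    unfolding Lambda_omega_Plus by (auto elim!: sum.not_neutral_contains_not_neutral split: if_splits)
  then show "card X + card Y = n \<and> Q (Suc (card Y))"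
    using assms unfolding bigraded_def by fastforce
qed

lemma bigraded_phi_mat: "bigraded 3 even (phi_mat m)"
  and bigraded_phi_hat_mat: "bigraded 3 odd (phi_hat_mat m)"
proof -
  have "card X + card Y = 3 \<and> (phi_mat m (X <+> Y) \<noteq> 0 \<longrightarrow> even (card Y))
      \<and> (phi_hat_mat m (X <+> Y) \<noteq> 0 \<longrightarrow> odd (card Y))"
    if nz: "phi_mat m (X <+> Y) \<noteq> 0 \<or> phi_hat_mat m (X <+> Y) \<noteq> 0" for X Y
  proof -
    have c2: "card (- {c}) = 2" for c :: 3 by (simp add: Compl_eq_Diff_UNIV card_Diff_subset)
    have c3: "card (X <+> Y) = 3"
      using nz homogeneousD[OF homogeneous_phi_mat] homogeneousD[OF homogeneous_phi_hat_mat] by metis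
    then show ?thesis
      by (cases rule: var_triple_cases) (auto simp: Plus_eq_iff c2)
  qed
  then show "bigraded 3 even (phi_mat m)" "bigraded 3 odd (phi_hat_mat m)"
    unfolding bigraded_def by blast+
qed

section \<open>The divergence-free cofactor matrix\<close>

lemma twice_diff_on_cof:
  assumes "\<And>a b. twice_diff_on U (\<lambda>v. G v $ a $ b)" "open U"
  shows "twice_diff_on U (\<lambda>v. cof (G v) j k)"
  unfolding cof_def by (intro twice_diff_on_diff twice_diff_on_mult assms)

text \<open>The Piola identity.  The hypothesis says that each column of \<open>G\<close> is the coefficient vector of a
closed 1-form \<open>\<Sum>\<^sub>a G\<^sub>a\<^sub>b dx\<^sup>a\<close>; then the wedge product of two of these forms is closed as well, and its
coefficients are the cofactors.\<close>
lemma cof_divergence_free: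
  fixes G :: "real^3 \<Rightarrow> real^3^3"
  assumes diff: "\<And>a b. (\<lambda>v. G v $ a $ b) differentiable at u"
    and D: "\<And>l a b. partial l (\<lambda>v. G v $ a $ b) u = partial a (\<lambda>v. G v $ l $ b) u"
  shows "(\<Sum>k\<in>UNIV. partial k (\<lambda>v. cof (G v) k c) u) = 0"
proof -
  have part: "partial l (\<lambda>v. cof (G v) a b) u =
      partial l (\<lambda>v. G v $ (a + 1) $ (b + 1)) u * G u $ (a + 2) $ (b + 2)
    + G u $ (a + 1) $ (b + 1) * partial l (\<lambda>v. G v $ (a + 2) $ (b + 2)) u
    - partial l (\<lambda>v. G v $ (a + 1) $ (b + 2)) u * G u $ (a + 2) $ (b + 1)
    - G u $ (a + 1) $ (b + 2) * partial l (\<lambda>v. G v $ (a + 2) $ (b + 1)) u" for l a b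
    unfolding cof_def by (simp add: dir_deriv_diff dir_deriv_mult diff)
  show ?thesis
    unfolding sum_3 part by (simp add: D[of 2 1] D[of 3 1] D[of 3 2])
qed

lemma cof_transpose: "cof (transpose m) j k = cof m k j"
  by (simp add: cof_def transpose_def mult.commute)

section \<open>The operator \<open>d \<Lambda> d\<close> on multiples of the imaginary part\<close>

lemma shuffle_sign_x_Y: "shuffle_sign {Inl k} ({} <+> Y :: var set) = (1::real)"
proof -
  have "\<not> rank_var i < rank_var (Inl k)" if "i \<in> {} <+> Y" for i
    using that by (auto simp: rank_var_def num3_def split: if_splits)
  then show ?thesis by (auto simp: shuffle_sign_eq_prod intro!: prod.neutral)
qed

lemma shuffle_sign_x_XX: "shuffle_sign {Inl k} (- {k} <+> {}) = sgn3 k"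
  using exhaust_3[of k] by (elim disjE; simp add: Compl_3 Plus_insert shuffle_sign_eq_prod sgn3_def)

lemma shuffle_sign_x_XXY: "shuffle_sign {Inl k} (- {k} <+> {c}) = sgn3 k"
  using exhaust_3[of k] exhaust_3[of c]
  by (elim disjE; simp add: Compl_3 Plus_insert shuffle_sign_eq_prod sgn3_def)

lemma shuffle_sign_y_YY: "shuffle_sign {Inr c} ({} <+> - {c}) = sgn3 c"
  using exhaust_3[of c] by (elim disjE; simp add: Compl_3 Plus_insert shuffle_sign_eq_prod sgn3_def)

lemma shuffle_sign_y_XX: "shuffle_sign {Inr c} (- {c} <+> {}) = (1::real)"
  using exhaust_3[of c] by (elim disjE; simp add: Compl_3 Plus_insert shuffle_sign_eq_prod)

lemma sgn3_square: "sgn3 k * (sgn3 k * x) = x"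
  by (simp add: sgn3_def)

lemma twice_diff_on_phi_hat_mat:
  assumes U: "open U" and G: "\<And>a b. twice_diff_on U (\<lambda>v. G v $ a $ b)"
  shows "twice_diff_on U (\<lambda>v. phi_hat_mat (G v) S)"
proof (cases "card S = 3")
  case True
  then show ?thesis
    by (cases rule: var_triple_cases)
      (simp_all add: twice_diff_on_mult[OF U] twice_diff_on_cof[OF G U])
next
  case False
  then show ?thesis by (simp add: homogeneousD[OF homogeneous_phi_hat_mat])
qed

lemma sum_only_at:
  fixes h :: "'a::finite \<Rightarrow> real"
  shows "(\<Sum>j\<in>UNIV. if j \<noteq> c then 0 else h j) = h c"
proof -
  have "(\<Sum>j\<in>UNIV. if j \<noteq> c then 0 else h j) = (\<Sum>j\<in>UNIV. if j = c then h j else 0)"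
    by (intro sum.cong) auto
  then show ?thesis by simp
qed

text \<open>The heart of the matter, for an arbitrary function \<open>f\<close>.  By parity \<open>d \<Lambda> d (f \<phi>')\<close> has the same two
types of components as \<open>\<phi>\<close>.  In each of them it is the directional derivative of \<open>\<phi>\<close>, as a function
of the matrix \<open>G\<close>, along the Hessian of \<open>f\<close>: for the entries of \<open>G\<close> these are the second derivatives
of \<open>f\<close>, for the determinant their pairing with the cofactors.\<close>
lemma d_Lambda_d_scaled_phi_hat:
  fixes G :: "real^3 \<Rightarrow> real^3^3" and f :: "real^3 \<Rightarrow> real"
  assumes U: "open U"
    and G: "\<And>a b. twice_diff_on U (\<lambda>v. G v $ a $ b)"
    and f: "twice_diff_on U f"
    and closed: "\<forall>v\<in>U. \<forall>l a b. partial l (\<lambda>v. G v $ a $ b) v = partial a (\<lambda>v. G v $ l $ b) v"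
    and sym: "\<forall>v\<in>U. \<forall>a b. G v $ a $ b = G v $ b $ a"
  defines "\<beta> \<equiv> \<lambda>v S. f v * phi_hat_mat (G v) S"
  defines "\<delta> \<equiv> \<lambda>v. Lambda_\<omega> (base_deriv \<beta> v)"
  shows "\<And>S. twice_diff_on U (\<lambda>v. \<beta> v S)"
    and "\<And>v S. v \<in> U \<Longrightarrow> (\<lambda>v. \<delta> v S) differentiable at v"
    and "\<And>u. u \<in> U \<Longrightarrow> bigraded 3 even (base_deriv \<delta> u)"
    and "\<And>u k c. u \<in> U \<Longrightarrow> base_deriv \<delta> u ({k} <+> - {c}) = - (sgn3 c * partial k (partial c f) u)"
    and "\<And>u. u \<in> U \<Longrightarrow> base_deriv \<delta> u (UNIV <+> {})
      = (\<Sum>k\<in>UNIV. \<Sum>c\<in>UNIV. partial k (partial c f) u * cof (G u) k c)"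
proof -
  show \<beta>2: "twice_diff_on U (\<lambda>v. \<beta> v S)" for S
    unfolding \<beta>_def by (intro twice_diff_on_mult U f twice_diff_on_phi_hat_mat G)
  note \<beta>1 = twice_diff_onD(1)[OF \<beta>2]
  have \<gamma>1: "(\<lambda>v. base_deriv \<beta> v S) differentiable at v" if "v \<in> U" for v S
    by (rule base_deriv_differentiable[OF \<beta>2 that])
  show \<delta>1: "(\<lambda>v. \<delta> v S) differentiable at v" if "v \<in> U" for v S
    unfolding \<delta>_def by (rule Lambda_omega_differentiable[OF \<gamma>1[OF that]])
  have "bigraded 3 odd (\<beta> v)" for v
    using bigraded_phi_hat_mat[of "G v"] unfolding bigraded_def \<beta>_def by auto
  then have "bigraded 4 odd (base_deriv \<beta> v)" if "v \<in> U" for v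
    using bigraded_base_deriv[OF _ U that \<beta>1[OF that]] by fastforce
  then have "bigraded 2 even (\<delta> v)" if "v \<in> U" for v
    using bigraded_Lambda_omega[of 2 odd] that unfolding \<delta>_def by fastforce
  then show "bigraded 3 even (base_deriv \<delta> u)" if "u \<in> U" for u
    using bigraded_base_deriv[OF _ U that \<delta>1[OF that]] by fastforce
  note f1 = twice_diff_onD(1)[OF f] and f2 = twice_diff_onD(2)[OF f]
  have cof1: "(\<lambda>v. cof (G v) j k) differentiable at v" if "v \<in> U" for v j k
    by (rule twice_diff_onD(1)[OF twice_diff_on_cof[OF G U] that])
  \<comment> \<open>The two exterior derivatives each produce a divergence of the cofactor matrix, the inner one over
    its first index and the outer one over its second.\<close>
  have cof_div_first: "(\<Sum>k\<in>UNIV. partial k (\<lambda>v. cof (G v) k c) v) = 0" if "v \<in> U" for v c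
    by (rule cof_divergence_free) (use that closed twice_diff_onD(1)[OF G] in auto)
  have "cof (G v) k c = cof (G v) c k" if "v \<in> U" for v k c
  proof -
    have "transpose (G v) = G v" using sym that by (simp add: transpose_def vec_eq_iff)
    then show ?thesis by (metis cof_transpose)
  qed
  note cof_sym = this
  then have "partial c (\<lambda>v. cof (G v) k c) v = partial c (\<lambda>v. cof (G v) c k) v" if "v \<in> U" for v k c
    using that by (intro dir_deriv_cong[OF U]) auto
  then have cof_div_second: "(\<Sum>c\<in>UNIV. partial c (\<lambda>v. cof (G v) k c) v) = 0" if "v \<in> U" for v k
    using cof_div_first that by simp
  have \<gamma>Y: "base_deriv \<beta> v ({c} <+> UNIV) = - partial c f v" if "v \<in> U" for v c
    using dir_deriv_cmult[OF f1[OF that], of "axis c 1" "-1"]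
    unfolding base_deriv_Plus[OF \<beta>1[OF that]] by (simp add: shuffle_sign_x_Y \<beta>_def)
  have \<gamma>X: "base_deriv \<beta> v (UNIV <+> {c}) = (\<Sum>k\<in>UNIV. partial k f v * cof (G v) k c)"
    if v: "v \<in> U" for v c
  proof -
    have "base_deriv \<beta> v (UNIV <+> {c})
        = (\<Sum>k\<in>UNIV. sgn3 k * partial k (\<lambda>v. sgn3 k * (f v * cof (G v) k c)) v)"
      unfolding base_deriv_Plus[OF \<beta>1[OF v]] Compl_eq_Diff_UNIV[symmetric] shuffle_sign_x_XXY
      by (simp add: \<beta>_def mult.left_commute)
    also have "\<dots> = (\<Sum>k\<in>UNIV. f v * partial k (\<lambda>v. cof (G v) k c) v + partial k f v * cof (G v) k c)"
      using f1[OF v] cof1[OF v] by (simp add: dir_deriv_cmult dir_deriv_mult sgn3_square)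
    also have "\<dots> = (\<Sum>k\<in>UNIV. partial k f v * cof (G v) k c)"
      using cof_div_first[OF v] by (simp add: sum.distrib sum_distrib_left[symmetric])
    finally show ?thesis .
  qed
  \<comment> \<open>In the contraction only the index that is missing on both sides contributes.\<close>
  have \<delta>Y: "\<delta> v ({} <+> - {c}) = - sgn3 c * partial c f v" if "v \<in> U" for v c
  proof -
    have "insert c (- {c}) = UNIV" by auto
    then show ?thesis
      by (simp add: \<delta>_def Lambda_omega_Plus sum_only_at
        shuffle_sign_y_YY shuffle_sign_x_Y \<gamma>Y[OF that])
  qed
  have \<delta>X: "\<delta> v (- {c} <+> {}) = sgn3 c * (\<Sum>k\<in>UNIV. partial k f v * cof (G v) k c)" if "v \<in> U" for v c
  proof -
    have "insert c (- {c}) = UNIV" by auto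
    then show ?thesis
      by (simp add: \<delta>_def Lambda_omega_Plus sum_only_at
        shuffle_sign_y_XX shuffle_sign_x_XXY \<gamma>X[OF that])
  qed
  fix u assume u: "u \<in> U"
  show "base_deriv \<delta> u ({k} <+> - {c}) = - (sgn3 c * partial k (partial c f) u)" for k c
  proof -
    have "base_deriv \<delta> u ({k} <+> - {c}) = partial k (\<lambda>v. \<delta> v ({} <+> - {c})) u"
      by (simp add: base_deriv_Plus[OF \<delta>1[OF u]] shuffle_sign_x_Y)
    also have "\<dots> = partial k (\<lambda>v. - sgn3 c * partial c f v) u"
      by (rule dir_deriv_cong[OF U u \<delta>Y])
    also have "\<dots> = - (sgn3 c * partial k (partial c f) u)"
      using dir_deriv_cmult[OF f2[OF u], of _ "- sgn3 c"] by simp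
    finally show ?thesis .
  qed
  show "base_deriv \<delta> u (UNIV <+> {})
      = (\<Sum>k\<in>UNIV. \<Sum>c\<in>UNIV. partial k (partial c f) u * cof (G u) k c)"
  proof -
    have summand: "partial c (\<lambda>v. \<delta> v (- {c} <+> {})) u
        = sgn3 c * (\<Sum>k\<in>UNIV. partial k f u * partial c (\<lambda>v. cof (G v) k c) u
            + partial c (partial k f) u * cof (G u) k c)" for c
    proof -
      have "partial c (\<lambda>v. \<delta> v (- {c} <+> {})) u
          = partial c (\<lambda>v. sgn3 c * (\<Sum>k\<in>UNIV. partial k f v * cof (G v) k c)) u"
        by (rule dir_deriv_cong[OF U u \<delta>X])
      also have "\<dots> = sgn3 c * (\<Sum>k\<in>UNIV. partial c (\<lambda>v. partial k f v * cof (G v) k c) u)"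
        using f2[OF u] cof1[OF u] by (simp add: dir_deriv_cmult dir_deriv_sum sum_differentiable)
      finally show ?thesis
        using f2[OF u] cof1[OF u] by (simp add: dir_deriv_mult)
    qed
    have "base_deriv \<delta> u (UNIV <+> {}) = (\<Sum>c\<in>UNIV. sgn3 c * partial c (\<lambda>v. \<delta> v (- {c} <+> {})) u)"
      by (simp add: base_deriv_Plus[OF \<delta>1[OF u]] Compl_eq_Diff_UNIV[symmetric] shuffle_sign_x_XX)
    also have "\<dots> = (\<Sum>c\<in>UNIV. \<Sum>k\<in>UNIV. partial k f u * partial c (\<lambda>v. cof (G v) k c) u)
        + (\<Sum>c\<in>UNIV. \<Sum>k\<in>UNIV. partial c (partial k f) u * cof (G u) k c)"
      by (simp add: summand sgn3_square sum.distrib)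
    also have "(\<Sum>c\<in>UNIV. \<Sum>k\<in>UNIV. partial k f u * partial c (\<lambda>v. cof (G v) k c) u)
        = (\<Sum>k\<in>UNIV. partial k f u * (\<Sum>c\<in>UNIV. partial c (\<lambda>v. cof (G v) k c) u))"
      unfolding sum_distrib_left by (rule sum.swap)
    also have "\<dots> = 0" by (simp add: cof_div_second[OF u])
    finally show ?thesis
      using cof_sym[OF u] by simp
  qed
qed

section \<open>Hessian metrics in affine charts\<close>

text \<open>The segment from the identity to \<open>m\<close> consists of positive definite, hence invertible, matrices,
so the determinant cannot change sign along it.\<close>
lemma pos_def_det_pos:
  fixes m :: "real^'n^'n"
  assumes pos: "\<And>v. v \<noteq> 0 \<Longrightarrow> v \<bullet> (m *v v) > 0"
  shows "det m > 0"
proof (rule ccontr)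
  define M where "M s = (1 - s) *\<^sub>R mat 1 + s *\<^sub>R m" for s :: real
  assume "\<not> det m > 0"
  then have "det (M 1) \<le> 0" "0 \<le> det (M 0)" by (simp_all add: M_def)
  moreover have "continuous_on {0..1} (\<lambda>s. det (M s))"
    unfolding det_def M_def by (intro continuous_intros)
  ultimately obtain s where s: "0 \<le> s" "s \<le> 1" "det (M s) = 0"
    using IVT2'[of "\<lambda>s. det (M s)" 1 0 0] by auto
  then obtain v where v: "v \<noteq> 0" "M s *v v = 0"
    using invertible_det_nz[of "M s"] unfolding invertible_left_inverse matrix_left_invertible_ker by auto
  have "M s *v v = (1 - s) *\<^sub>R v + s *\<^sub>R (m *v v)"
    by (simp add: M_def matrix_vector_mult_add_rdistrib scaleR_matrix_vector_assoc[symmetric])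
  then have "(1 - s) * (v \<bullet> v) + s * (v \<bullet> (m *v v)) = 0"
    using v(2) by (metis inner_add_right inner_scaleR_right inner_zero_right)
  moreover have "(1 - s) * (v \<bullet> v) \<ge> 0" "s * (v \<bullet> (m *v v)) \<ge> 0"
    using s pos[OF v(1)] by auto
  ultimately have "(1 - s) * (v \<bullet> v) = 0" "s * (v \<bullet> (m *v v)) = 0" by linarith+
  then show False using v(1) pos[OF v(1)] by auto
qed

lemma chart_facts:
  assumes "special_integral_affine \<A>" "c \<in> \<A>"
  shows open_cimg: "open (cimg c)"
    and cinv_cmap: "p \<in> cdom c \<Longrightarrow> cinv c (cmap c p) = p"
    and cmap_cimg: "p \<in> cdom c \<Longrightarrow> cmap c p \<in> cimg c"
    and cmap_cinv: "u \<in> cimg c \<Longrightarrow> cmap c (cinv c u) = u"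
    and cinv_cdom: "u \<in> cimg c \<Longrightarrow> cinv c u \<in> cdom c"
proof -
  have "open (cimg c)" and h: "homeomorphism (cdom c) (cimg c) (cmap c) (cinv c)"
    using assms unfolding special_integral_affine_def by auto
  then show "open (cimg c)" by simp
  show "p \<in> cdom c \<Longrightarrow> cinv c (cmap c p) = p" "p \<in> cdom c \<Longrightarrow> cmap c p \<in> cimg c"
    "u \<in> cimg c \<Longrightarrow> cmap c (cinv c u) = u" "u \<in> cimg c \<Longrightarrow> cinv c u \<in> cdom c"
    using h unfolding homeomorphism_def by auto
qed

lemma hessian_metricD:
  assumes "hessian_metric \<A> g"
  shows "c \<in> \<A> \<Longrightarrow> p \<in> cdom c \<Longrightarrow> 0 < det (g c p)"
    and "c \<in> \<A> \<Longrightarrow> p \<in> cdom c \<Longrightarrow> g c p $ j $ k = g c p $ k $ j"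
    and "c \<in> \<A> \<Longrightarrow> smooth_on (cimg c) (\<lambda>u. g c (cinv c u) $ j $ k)"
    and "c \<in> \<A> \<Longrightarrow> c' \<in> \<A> \<Longrightarrow> transition_at c c' p A \<Longrightarrow> g c p = transpose A ** g c' p ** A"
    and "c \<in> charts_at \<A> p \<Longrightarrow> \<exists>V \<psi>. local_potential c g p V \<psi>"
proof -
  have R: "riemannian_metric \<A> g" using assms by (simp add: hessian_metric_def)
  show "c \<in> \<A> \<Longrightarrow> p \<in> cdom c \<Longrightarrow> 0 < det (g c p)"
    using R unfolding riemannian_metric_def by (intro pos_def_det_pos) auto
  show "g c p $ j $ k = g c p $ k $ j" if "c \<in> \<A>" "p \<in> cdom c"
  proof -
    have "transpose (g c p) = g c p" using R that unfolding riemannian_metric_def by blast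
    then show ?thesis by (metis (no_types, lifting) transpose_def vec_lambda_beta)
  qed
qed (use assms in \<open>unfold hessian_metric_def riemannian_metric_def, blast+\<close>)

lemma det_metric_chart_independent:
  assumes "special_integral_affine \<A>" "hessian_metric \<A> g"
    and c: "c \<in> charts_at \<A> p" "c' \<in> charts_at \<A> p"
  shows "det (g c p) = det (g c' p)"
proof -
  have c: "c \<in> \<A>" "c' \<in> \<A>" "p \<in> cdom c \<inter> cdom c'"
    using c by (auto simp: charts_at_def)
  then obtain A where A: "A \<in> SL3Z" "transition_at c c' p A"
    using assms(1) unfolding special_integral_affine_def by blast
  then show ?thesis
    using hessian_metricD(4)[OF assms(2) c(1,2) A(2)] by (simp add: det_mul SL3Z_def)
qed

text \<open>The potential chosen in \<open>dz\<close> is only known near the base point; there its second derivatives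
are the entries of the metric, whichever potential was chosen.\<close>
lemma dz_eq_dz_row:
  assumes sia: "special_integral_affine \<A>" and g: "hessian_metric \<A> g"
    and c: "c \<in> charts_at \<A> (fst q)"
  shows "dz g j c q = dz_row (g c (fst q)) j"
proof
  fix S :: "var set"
  define p where "p = fst q"
  define w where "w = coords c q"
  define \<psi> where "\<psi> = potential c g p"
  have cA: "c \<in> \<A>" "p \<in> cdom c" using c by (auto simp: charts_at_def p_def)
  have "\<exists>\<psi>. \<exists>V. local_potential c g p V \<psi>"
    using hessian_metricD(5)[OF g c] by (auto simp: p_def)
  then have "\<exists>V. local_potential c g p V \<psi>"
    unfolding \<psi>_def potential_def by (rule someI_ex)
  then obtain V where V: "open V" "cmap c p \<in> V" "smooth_on V \<psi>"
    "\<And>u j k. u \<in> V \<Longrightarrow> g c (cinv c u) $ j $ k = partial j (partial k \<psi>) u"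
    unfolding local_potential_def by blast
  have w: "fst w = cmap c p" by (simp add: w_def coords_def p_def)
  have part: "partial k (partial j \<psi>) (fst w) = g c p $ k $ j" for k
    using V(4)[OF V(2)] cinv_cmap[OF sia cA] by (simp add: w)
  have diff: "partial j \<psi> differentiable at (fst w)"
    unfolding w by (intro smooth_on_differentiable[OF V(1) smooth_on_dir_deriv[OF V(1,3)] V(2)])
  have "((\<lambda>w. of_real (partial j \<psi> (fst w)) + \<i> * of_real (snd w $ j)) has_derivative
      (\<lambda>h. of_real (dir_deriv (fst h) (partial j \<psi>) (fst w)) + \<i> * of_real (snd h $ j))) (at w)"
    by (intro has_derivative_add has_derivative_of_real has_derivative_mult_right bounded_linear.has_derivative[OF bounded_linear_vec_nth]
      has_derivative_snd has_derivative_ident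
      has_derivative_compose[OF has_derivative_fst[OF has_derivative_ident] dir_deriv_works[OF diff]])
  then have "dir_deriv h (z_coord c g p j) w
      = of_real (dir_deriv (fst h) (partial j \<psi>) (fst w)) + \<i> * of_real (snd h $ j)" for h
    unfolding z_coord_def[abs_def] \<psi>_def[symmetric] Complex_eq by (rule dir_deriv_eqI)
  then have z: "dir_deriv (frame (Inl k)) (z_coord c g p j) w = of_real (g c p $ k $ j)"
    "dir_deriv (frame (Inr k)) (z_coord c g p j) w = (if k = j then \<i> else 0)" for k
    using diff by (simp_all add: part) (simp add: axis_def)
  have ext: "dz g j c q S = (\<Sum>i\<in>S. shuffle_sign {i} (S - {i}) *
      (if S = {i} then dir_deriv (frame i) (z_coord c g p j) w else 0))"
    unfolding dz_def ext_deriv_def p_def[symmetric] w_def[symmetric]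
  proof (intro sum.cong refl arg_cong2[where f = "(*)"])
    fix i assume i: "i \<in> S"
    show "dir_deriv (frame i) (\<lambda>w'. func_form (z_coord c g p j) w' (S - {i})) w
        = (if S = {i} then dir_deriv (frame i) (z_coord c g p j) w else 0)"
    proof (cases "S = {i}")
      case False
      then have "S - {i} \<noteq> {}" using i by auto
      then show ?thesis using False by (simp add: func_form_def)
    qed (simp add: func_form_def)
  qed
  show "dz g j c q S = dz_row (g c (fst q)) j S"
  proof (cases "\<exists>i. S = {i}")
    case True
    then obtain i where "S = {i}" ..
    then show ?thesis
      unfolding ext p_def[symmetric] by (cases i) (simp_all add: z del: frame_simps)
  next
    case False
    then have "card S \<noteq> 1" by (simp add: card_1_singleton_iff)
    then have "dz_row (g c (fst q)) j S = 0" by (rule homogeneousD[OF homogeneous_dz_row])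
    moreover have "dz g j c q S = 0" unfolding ext using False by (intro sum.neutral) auto
    ultimately show ?thesis by simp
  qed
qed

lemma
  assumes "special_integral_affine \<A>" "hessian_metric \<A> g" "c \<in> charts_at \<A> (fst q)"
  shows phi_eq_phi_mat: "phi g c q = phi_mat (g c (fst q))"
    and phi_hat_eq_phi_hat_mat: "phi_hat g c q = phi_hat_mat (g c (fst q))"
  by (simp_all add: fun_eq_iff phi_def phi_hat_def Omega_def phi_mat_def phi_hat_mat_def Omega_mat_def
    dz_eq_dz_row[OF assms])

text \<open>The defining equation holds in all charts at once since \<open>det g\<close> is the same in all of them, and it
determines the value because \<open>\<omega>\<^sup>3\<close> is not zero.\<close>
lemma norm_sq_phi_eq_det:
  assumes sia: "special_integral_affine \<A>" and g: "hessian_metric \<A> g" and c: "c \<in> charts_at \<A> (fst q)"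
  shows "norm_sq_phi \<A> g q = 4 * det (g c (fst q))"
  unfolding norm_sq_phi_def
proof (rule the_equality)
  have "phi g c' q \<and>\<and> phi_hat g c' q
      = (\<lambda>S. 4 * det (g c (fst q)) * ((omega \<and>\<and> omega \<and>\<and> omega) S / fact 3))"
    if c': "c' \<in> charts_at \<A> (fst q)" for c'
    unfolding phi_eq_phi_mat[OF sia g c'] phi_hat_eq_phi_hat_mat[OF sia g c'] phi_wedge_phi_hat
    using det_metric_chart_independent[OF sia g c c'] by simp
  then show "\<forall>c'\<in>charts_at \<A> (fst q). phi g c' q \<and>\<and> phi_hat g c' q
      = (\<lambda>S. 4 * det (g c (fst q)) * ((omega \<and>\<and> omega \<and>\<and> omega) S / fact 3))"
    by blast
  then have eq: "phi g c q \<and>\<and> phi_hat g c q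
      = (\<lambda>S. 4 * det (g c (fst q)) * ((omega \<and>\<and> omega \<and>\<and> omega) S / fact 3))"
    using c by blast
  fix r
  assume "\<forall>c\<in>charts_at \<A> (fst q). phi g c q \<and>\<and> phi_hat g c q
      = (\<lambda>S. r * ((omega \<and>\<and> omega \<and>\<and> omega) S / fact 3))"
  with c eq have "(\<lambda>S. r * ((omega \<and>\<and> omega \<and>\<and> omega) S / fact 3))
      = (\<lambda>S. 4 * det (g c (fst q)) * ((omega \<and>\<and> omega \<and>\<and> omega) S / fact 3))"
    by simp
  from fun_cong[OF this, of UNIV] show "r = 4 * det (g c (fst q))"
    by (simp add: omega_cubed_UNIV)
qed

text \<open>Both sides are third derivatives of a local potential, taken in a different order.\<close>
lemma hessian_metric_closed:
  assumes sia: "special_integral_affine \<A>" and g: "hessian_metric \<A> g" and c: "c \<in> \<A>" and u: "u \<in> cimg c"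
  shows "partial l (\<lambda>v. g c (cinv c v) $ a $ b) u = partial a (\<lambda>v. g c (cinv c v) $ l $ b) u"
proof -
  have "c \<in> charts_at \<A> (cinv c u)" using cinv_cdom[OF sia c u] c by (simp add: charts_at_def)
  then obtain V \<psi> where V: "local_potential c g (cinv c u) V \<psi>"
    using hessian_metricD(5)[OF g] by blast
  then have V: "open V" "u \<in> V" "smooth_on V \<psi>"
    and \<psi>: "\<And>v j k. v \<in> V \<Longrightarrow> g c (cinv c v) $ j $ k = partial j (partial k \<psi>) v"
    using cmap_cinv[OF sia c u] unfolding local_potential_def by auto
  have "partial l (\<lambda>v. g c (cinv c v) $ a $ b) u = partial l (partial a (partial b \<psi>)) u" for l a
    using \<psi> by (intro dir_deriv_cong[OF V(1,2)])
  then show ?thesis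
    using smooth_on_dir_deriv_commute[OF V(1) smooth_on_dir_deriv[OF V(1,3)] V(2)] by metis
qed

text \<open>All forms in the theorem are of this kind, which reduces the theorem to an identity between
functions on an open subset of \<open>\<real>\<^sup>3\<close>.\<close>
definition fibre_invariant_on :: "'b chart \<Rightarrow> ('b, real) xform \<Rightarrow> (real^3 \<Rightarrow> real form) \<Rightarrow> bool" where
  "fibre_invariant_on c \<alpha> A \<longleftrightarrow> (\<forall>q. fst q \<in> cdom c \<longrightarrow> \<alpha> c q = A (cmap c (fst q)))"

lemma fibre_invariant_onD: "fibre_invariant_on c \<alpha> A \<Longrightarrow> fst q \<in> cdom c \<Longrightarrow> \<alpha> c q = A (cmap c (fst q))"
  unfolding fibre_invariant_on_def by blast

lemma fibre_invariant_on_d_Xhat: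
  assumes sia: "special_integral_affine \<A>" and c: "c \<in> \<A>"
    and A: "fibre_invariant_on c \<alpha> A" and diff: "\<And>u S. u \<in> cimg c \<Longrightarrow> (\<lambda>v. A v S) differentiable at u"
  shows "fibre_invariant_on c (d_Xhat \<A> \<alpha>) (base_deriv A)"
  unfolding fibre_invariant_on_def
proof (intro allI impI)
  fix q :: "'a xpoint" assume q: "fst q \<in> cdom c"
  have w: "fst (coords c q) = cmap c (fst q)" by (simp add: coords_def)
  note F = chart_facts[OF sia c]
  have "ext_deriv (\<lambda>w. \<alpha> c (param \<A> c w)) (coords c q) = base_deriv A (fst (coords c q))"
  proof (rule ext_deriv_fibre_invariant)
    show "open (cimg c)" "fst (coords c q) \<in> cimg c" using F(1) F(3)[OF q] w by auto
    show "\<alpha> c (param \<A> c v) = A (fst v)" if "fst v \<in> cimg c" for v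
      using A F(4,5)[OF that] unfolding fibre_invariant_on_def by (simp add: param_def Let_def)
    show "(\<lambda>u. A u S) differentiable at (fst (coords c q))" for S
      using diff F(3)[OF q] w by simp
  qed
  then show "d_Xhat \<A> \<alpha> c q = base_deriv A (cmap c (fst q))"
    by (simp add: d_Xhat_def w)
qed

lemma fibre_invariant_on_Lambda_Xhat:
  "fibre_invariant_on c \<alpha> A \<Longrightarrow> fibre_invariant_on c (Lambda_Xhat \<alpha>) (\<lambda>u. Lambda_\<omega> (A u))"
  by (simp add: fibre_invariant_on_def Lambda_Xhat_def[abs_def])

section \<open>The flow\<close>

text \<open>Jacobi's formula.\<close>
lemma DERIV_det_3:
  fixes M :: "real \<Rightarrow> real^3^3"
  assumes "\<And>j k. ((\<lambda>s. M s $ j $ k) has_real_derivative M' j k) (at t within I)"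
  shows "((\<lambda>s. det (M s)) has_real_derivative (\<Sum>k\<in>UNIV. \<Sum>c\<in>UNIV. M' k c * cof (M t) k c)) (at t within I)"
  unfolding det_3 sum_3 cof_def
  by (rule derivative_eq_intros assms refl)+ (simp add: algebra_simps)

theorem theorem2p4:
  fixes \<A> :: "'b::t2_space chart set"
    and I :: "real set"
    and g :: "real \<Rightarrow> 'b metric"
  assumes "compact (UNIV :: 'b set)"
    and "special_integral_affine \<A>"
    and "is_interval I" and "interior I \<noteq> {}"
    and "\<And>t. t \<in> I \<Longrightarrow> hessian_metric \<A> (g t)"
    and "smooth_metric_family \<A> I g"
    and "hessian_flow \<A> I g"
  shows "\<forall>t\<in>I. \<forall>q\<in>Xhat \<A>. \<forall>c\<in>charts_at \<A> (fst q). \<forall>S.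
    ((\<lambda>s. phi (g s) c q S) has_real_derivative
       1/2 * d_Xhat \<A> (Lambda_Xhat (d_Xhat \<A>
         (scale_Xhat (\<lambda>q. ln (norm_sq_phi \<A> (g t) q)) (phi_hat (g t))))) c q S)
      (at t within I)"
proof (intro ballI allI)
  fix t c S and q :: "'b xpoint"
  assume t: "t \<in> I" and cp: "c \<in> charts_at \<A> (fst q)"
  note sia = assms(2) and metric = assms(5)
  define p where "p = fst q"
  have c: "c \<in> \<A>" and p: "p \<in> cdom c" using cp by (auto simp: charts_at_def p_def)
  define G where "G v = g t c (cinv c v)" for v
  define F where "F v = ln (det (G v))" for v
  define f where "f v = ln (4 * det (G v))" for v
  define \<beta> where "\<beta> = (\<lambda>v S. f v * phi_hat_mat (G v) S)"
  define \<delta> where "\<delta> = (\<lambda>v. Lambda_\<omega> (base_deriv \<beta> v))"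
  define U where "U = cimg c"
  define u where "u = cmap c p"
  have U: "open U" and u: "u \<in> U" and Gu: "G u = g t c p"
    using chart_facts[OF sia c] p by (auto simp: U_def u_def G_def)
  have G2: "twice_diff_on U (\<lambda>v. G v $ a $ b)" for a b
    unfolding G_def U_def
    by (intro smooth_on_twice_diff_on open_cimg[OF sia c] hessian_metricD(3)[OF metric[OF t] c])
  have det_pos: "det (G v) > 0" if "v \<in> U" for v
    using cinv_cdom[OF sia c] that by (simp add: G_def U_def hessian_metricD(1)[OF metric[OF t] c])
  have det2: "twice_diff_on U (\<lambda>v. det (G v))"
    unfolding det_3 by (intro twice_diff_on_add twice_diff_on_diff twice_diff_on_mult U G2)
  have F2: "twice_diff_on U F"
    unfolding F_def by (rule twice_diff_on_ln[OF U det2 det_pos])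
  \<comment> \<open>The flow is stated with \<open>log det g\<close>, the claim with \<open>log (4 det g)\<close>; their derivatives agree.\<close>
  have f_F: "f v = ln 4 + F v" if "v \<in> U" for v
    using det_pos[OF that] by (simp add: f_def F_def ln_mult)
  have f2: "twice_diff_on U f"
    unfolding f_def by (intro twice_diff_on_ln[OF U] twice_diff_on_mult[OF U] det2) (auto simp: det_pos)
  have "partial k f v = partial k F v" if "v \<in> U" for k v
    using dir_deriv_cong[OF U that f_F] twice_diff_onD(1)[OF F2 that] by (simp add: dir_deriv_add)
  then have hess_f: "partial j (partial k f) u = partial j (partial k F) u" for j k
    by (intro dir_deriv_cong[OF U u])
  have closed: "\<forall>v\<in>U. \<forall>l a b. partial l (\<lambda>v. G v $ a $ b) v = partial a (\<lambda>v. G v $ l $ b) v"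
    using hessian_metric_closed[OF sia metric[OF t] c] unfolding G_def U_def by blast
  have sym: "\<forall>v\<in>U. \<forall>a b. G v $ a $ b = G v $ b $ a"
    using hessian_metricD(2)[OF metric[OF t] c cinv_cdom[OF sia c]] unfolding G_def U_def by blast
  note core = d_Lambda_d_scaled_phi_hat[OF U G2 f2 closed sym, folded \<beta>_def, folded \<delta>_def]

  have "fibre_invariant_on c (scale_Xhat (\<lambda>q. ln (norm_sq_phi \<A> (g t) q)) (phi_hat (g t))) \<beta>"
    unfolding fibre_invariant_on_def
  proof (intro allI impI)
    fix q' :: "'b xpoint" assume q': "fst q' \<in> cdom c"
    then have c': "c \<in> charts_at \<A> (fst q')" using c by (simp add: charts_at_def)
    have "G (cmap c (fst q')) = g t c (fst q')" by (simp add: G_def cinv_cmap[OF sia c q'])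
    then show "scale_Xhat (\<lambda>q. ln (norm_sq_phi \<A> (g t) q)) (phi_hat (g t)) c q' = \<beta> (cmap c (fst q'))"
      by (simp add: scale_Xhat_def \<beta>_def f_def norm_sq_phi_eq_det[OF sia metric[OF t] c']
        phi_hat_eq_phi_hat_mat[OF sia metric[OF t] c'])
  qed
  then have "fibre_invariant_on c (d_Xhat \<A> (Lambda_Xhat (d_Xhat \<A>
      (scale_Xhat (\<lambda>q. ln (norm_sq_phi \<A> (g t) q)) (phi_hat (g t)))))) (base_deriv \<delta>)"
    unfolding \<delta>_def
    using core(2) twice_diff_onD(1)[OF core(1)]
    by (intro fibre_invariant_on_d_Xhat[OF sia c] fibre_invariant_on_Lambda_Xhat) (auto simp: U_def \<delta>_def \<beta>_def)
  then have rhs: "d_Xhat \<A> (Lambda_Xhat (d_Xhat \<A>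
      (scale_Xhat (\<lambda>q. ln (norm_sq_phi \<A> (g t) q)) (phi_hat (g t))))) c q S = base_deriv \<delta> u S"
    by (simp only: fibre_invariant_onD p[unfolded p_def] p_def u_def)

  have flow: "((\<lambda>s. g s c p $ j $ k) has_real_derivative 1/2 * partial j (partial k f) u) (at t within I)" for j k
    using assms(7) t cp unfolding hessian_flow_def hess_f
    by (simp add: p_def u_def F_def[abs_def] G_def)
  have "((\<lambda>s. phi_mat (g s c p) S) has_real_derivative 1/2 * base_deriv \<delta> u S) (at t within I)"
  proof (cases "card S = 3")
    case True
    have odd_vanish: "phi_mat m (X <+> Y) = 0 \<and> base_deriv \<delta> u (X <+> Y) = 0" if "odd (card Y)" for m X Y
      using bigraded_phi_mat[of m] core(3)[OF u] that unfolding bigraded_def by blast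
    from True show ?thesis
    proof (cases rule: var_triple_cases)
      case 1
      have "((\<lambda>s. det (g s c p)) has_real_derivative
          (\<Sum>k\<in>UNIV. \<Sum>c'\<in>UNIV. (1/2 * partial k (partial c' f) u) * cof (g t c p) k c')) (at t within I)"
        by (rule DERIV_det_3[OF flow])
      then show ?thesis
        by (simp add: 1 core(5)[OF u] Gu sum_distrib_left mult.assoc)
    next
      case (2 k d)
      then show ?thesis using odd_vanish[of "{d}"] by simp
    next
      case (3 k d)
      then show ?thesis
        using DERIV_cmult[OF flow[of k d], of "- sgn3 d"]
        by (simp add: core(4)[OF u] mult.left_commute)
    next
      case 4
      then show ?thesis using odd_vanish[of UNIV] by simp
    qed
  next
    case False
    obtain X Y where S: "S = X <+> Y" by (rule var_set_Plus)
    then have "card X + card Y \<noteq> 3" using False by (simp add: card_Plus)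
    then have "phi_mat m S = 0" "base_deriv \<delta> u S = 0" for m
      using bigraded_phi_mat[of m] core(3)[OF u] unfolding bigraded_def S by blast+
    then show ?thesis by simp
  qed
  then show "((\<lambda>s. phi (g s) c q S) has_real_derivative
       1/2 * d_Xhat \<A> (Lambda_Xhat (d_Xhat \<A>
         (scale_Xhat (\<lambda>q. ln (norm_sq_phi \<A> (g t) q)) (phi_hat (g t))))) c q S)
      (at t within I)"
    unfolding rhs
    by (rule has_field_derivative_transform_within[OF _ zero_less_one t])
      (simp add: phi_eq_phi_mat[OF sia metric cp] p_def)
qed

end
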